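(* Let $\kappa$ be a field, let $S_1,S_2\subseteq\mathbb{N}^d$ be positive affine semigroups, and let $R_1=\kappa[\mathbf{u}^{S_1}]$, $R_2=\kappa[\mathbf{u}^{S_2}]$. Suppose that $S_1$ and $S_2$ can be glued, by means of positive integers $a,b$, with gluing $\kappa[\mathbf{u}^{aS_1+bS_2}]$. Let $R=\kappa[t]$ be the polynomial ring in one variable. Then there are homomorphisms of affine semigroup rings $R\to R_1$ and $R\to R_2$ such that the gluing $\kappa[\mathbf{u}^{aS_1+bS_2}]$ is isomorphic to $R_1\otimes_R R_2$. Furthermore, for these homomorphisms, $R_1\,\widetilde{\otimes}_R\,R_2\simeq R_1\otimes_R R_2$.
   Context: $\mathbb{N}$ is the set of non-negative integers. Monoids are commutative, written additively with identity $0$. An affine semigroup is a finitely generated, cancellative, torsion-free monoid; it is positive if $0$ is its only invertible element. For $S\subseteq\mathbb{N}^d$, $\kappa[\mathbf{u}^S]$ is the $\kappa$-subalgebra of $\kappa[u_1,\dots,u_d]$ spanned by the monomials $\mathbf{u}^s$, $s\in S$; in general $\kappa[\mathbf{w}^S]$ is the monoid ring of $S$. A homomorphism of affine semigroup rings is a $\kappa$-algebra homomorphism induced by a homomorphism of the semigroups; $R=\kappa[t]=\kappa[t^{\mathbb{N}}]$. Gluing. Let $S_1=\langle s_1,\dots,s_n\rangle$ and $S_2=\langle t_1,\dots,t_m\rangle$ in $\mathbb{N}^d$. $S_1$ and $S_2$ can be glued (by means of positive integers $a,b$; also phrased: $R_1$ and $R_2$ can be glued along a polynomial ring in one variable in some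 finer embedding) if the $\kappa$-algebra homomorphisms $\varphi_1:\kappa[X_1,\dots,X_n]\to\kappa[\mathbf{u}^{aS_1}]$, $\varphi_2:\kappa[Y_1,\dots,Y_m]\to\kappa[\mathbf{u}^{bS_2}]$, $\varphi:\kappa[X_1,\dots,X_n,Y_1,\dots,Y_m]\to\kappa[\mathbf{u}^{aS_1+bS_2}]$ given by $\varphi(X_i)=\varphi_1(X_i)=\mathbf{u}^{as_i}$ and $\varphi(Y_j)=\varphi_2(Y_j)=\mathbf{u}^{bt_j}$ satisfy $$\ker\varphi=\ker\varphi_1+\ker\varphi_2+\langle X_1^{i_1}\cdots X_n^{i_n}-Y_1^{j_1}\cdots Y_m^{j_m}\rangle$$ (ideals of $\kappa[X_1,\dots,X_n,Y_1,\dots,Y_m]$, where $\ker\varphi_1,\ker\varphi_2$ stand for the ideals they generate) for some monomials $X_1^{i_1}\cdots X_n^{i_n}$ and $Y_1^{j_1}\cdots Y_m^{j_m}$ whose common image under $\varphi$ is different from $1$. The ring $\kappa[\mathbf{u}^{aS_1+bS_2}]$ is then called the gluing. Fibered sum. For homomorphisms $S\to S_1$, $S\to S_2$ of affine semigroups, with $\mathrm{Grp}(\cdot)$ the group of differences, let $S_1\oplus_S S_2$ be the image of $S_1\oplus S_2$ in $(\mathrm{Grp}(S_1)\oplus\mathrm{Grp}(S_2))/\{(s,-s):s\in\mathrm{Grp}(S)\}$ (elements of $\mathrm{Grp}(S)$ being identified with their images), and let $S_1\,\widetilde{\oplus}_S\,S_2=(S_1\oplus_S S_2)/\!\sim_{\mathrm{tor}}$,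 where $x\sim_{\mathrm{tor}}y$ iff $nx=ny$ for some positive integer $n$. For $R=\kappa[S]$, $R_i=\kappa[S_i]$ with the induced homomorphisms $R\to R_i$, put $R_1\,\widetilde{\otimes}_R\,R_2:=\kappa[\mathbf{w}^{S_1\widetilde{\oplus}_S S_2}]$. *)

theory Defs
  imports "HOL.Hull" "HOL-Library.Poly_Mapping" "HOL-Algebra.Divisibility" "HOL-Algebra.QuotRing" "HOL-Algebra.Module"
begin

section \<open>Affine semigroups\<close>

text \<open>
  Commutative monoids are the multiplicatively written monoids of HOL-Algebra; a submonoid
  of an additive type is turned into such a record by \<open>additive_monoid\<close>. In particular
  \<open>x [^] n\<close> is the multiple written \<open>n x\<close> in additive notation.
\<close>

definition additive_monoid :: "'a::comm_monoid_add set \<Rightarrow> 'a monoid" where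
  "additive_monoid S = \<lparr>carrier = S, mult = (+), one = 0\<rparr>"

definition generates :: "('a, 'c) monoid_scheme \<Rightarrow> 'a set \<Rightarrow> bool" where
  "generates G A \<longleftrightarrow> A \<subseteq> carrier G \<and> carrier G = (\<lambda>H. submonoid H G) hull A"

definition torsion_free :: "('a, 'c) monoid_scheme \<Rightarrow> bool" where
  "torsion_free G \<longleftrightarrow> (\<forall>x\<in>carrier G. \<forall>y\<in>carrier G. \<forall>n::nat.
     n > 0 \<longrightarrow> x [^]\<^bsub>G\<^esub> n = y [^]\<^bsub>G\<^esub> n \<longrightarrow> x = y)"

definition affine_semigroup :: "('a, 'c) monoid_scheme \<Rightarrow> bool" where
  "affine_semigroup G \<longleftrightarrow>
     comm_monoid_cancel G \<and> (\<exists>A. finite A \<and> generates G A) \<and> torsion_free G"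

definition positive_affine_semigroup :: "('a, 'c) monoid_scheme \<Rightarrow> bool" where
  "positive_affine_semigroup G \<longleftrightarrow> affine_semigroup G \<and> Units G = {\<one>\<^bsub>G\<^esub>}"

definition monoid_hom :: "('a, 'c) monoid_scheme \<Rightarrow> ('b, 'e) monoid_scheme \<Rightarrow> ('a \<Rightarrow> 'b) set" where
  "monoid_hom G H = {h \<in> hom G H. h \<one>\<^bsub>G\<^esub> = \<one>\<^bsub>H\<^esub>}"

text \<open>
  Exponent vectors with variables indexed by \<open>V\<close>; \<open>exponents {1..d}\<close> is the monoid \<open>N^d\<close>.
\<close>

definition exponents :: "'v set \<Rightarrow> ('v \<Rightarrow>\<^sub>0 nat) set" where
  "exponents V = {e. Poly_Mapping.keys e \<subseteq> V}"

definition multiple :: "nat \<Rightarrow> ('v \<Rightarrow>\<^sub>0 nat) \<Rightarrow> ('v \<Rightarrow>\<^sub>0 nat)" where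
  "multiple c e = Poly_Mapping.map ((*) c) e"

section \<open>Algebras and monoid rings\<close>

text \<open>
  A \<open>k\<close>-algebra is a \<open>module\<close> record, which carries a ring structure together with the
  scalar multiplication; the scalars are all elements of the type \<open>'k\<close>.
\<close>

definition algebra_hom :: "('k, 'a) module \<Rightarrow> ('k, 'b) module \<Rightarrow> ('a \<Rightarrow> 'b) set" where
  "algebra_hom A B =
     {h \<in> ring_hom A B. \<forall>c. \<forall>x\<in>carrier A. h (c \<odot>\<^bsub>A\<^esub> x) = c \<odot>\<^bsub>B\<^esub> h x}"

definition algebra_isomorphic :: "('k, 'a) module \<Rightarrow> ('k, 'b) module \<Rightarrow> bool" where
  "algebra_isomorphic A B \<longleftrightarrow> (\<exists>h\<in>algebra_hom A B. bij_betw h (carrier A) (carrier B))"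

text \<open>
  An element of the monoid ring is the finitely supported family of its coefficients, so
  \<open>single x 1\<close> is the monomial \<open>w^x\<close>. The ring \<open>k[u^S]\<close> is
  \<open>monoid_algebra \<kappa> (additive_monoid S)\<close>, and the polynomial ring with variables indexed
  by \<open>V\<close> is the special case \<open>S = exponents V\<close>.
\<close>

definition monoid_algebra ::
  "'k::comm_ring_1 itself \<Rightarrow> ('a, 'c) monoid_scheme \<Rightarrow> ('k, 'a \<Rightarrow>\<^sub>0 'k) module" where
  "monoid_algebra \<kappa> G =
     \<lparr>carrier = {p. Poly_Mapping.keys p \<subseteq> carrier G},
      mult = (\<lambda>p q. \<Sum>x\<in>Poly_Mapping.keys p. \<Sum>y\<in>Poly_Mapping.keys q.
                Poly_Mapping.single (x \<otimes>\<^bsub>G\<^esub> y) (Poly_Mapping.lookup p x * Poly_Mapping.lookup q y)),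
      one = Poly_Mapping.single \<one>\<^bsub>G\<^esub> 1,
      zero = 0,
      add = (+),
      smult = (\<lambda>c p. Poly_Mapping.map ((*) c) p)\<rparr>"

abbreviation semigroup_ring ::
  "'k::comm_ring_1 itself \<Rightarrow> 'a::comm_monoid_add set \<Rightarrow> ('k, 'a \<Rightarrow>\<^sub>0 'k) module" where
  "semigroup_ring \<kappa> S \<equiv> monoid_algebra \<kappa> (additive_monoid S)"

abbreviation polynomial_ring ::
  "'k::comm_ring_1 itself \<Rightarrow> 'v set \<Rightarrow> ('k, ('v \<Rightarrow>\<^sub>0 nat) \<Rightarrow>\<^sub>0 'k) module" where
  "polynomial_ring \<kappa> V \<equiv> semigroup_ring \<kappa> (exponents V)"

abbreviation monomial :: "'a \<Rightarrow> ('a \<Rightarrow>\<^sub>0 'k::comm_ring_1)" where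
  "monomial x \<equiv> Poly_Mapping.single x 1"

abbreviation variable :: "'v \<Rightarrow> (('v \<Rightarrow>\<^sub>0 nat) \<Rightarrow>\<^sub>0 'k::comm_ring_1)" where
  "variable v \<equiv> monomial (Poly_Mapping.single v 1)"

text \<open>
  Homomorphisms of semigroup rings: \<open>f\<close> is a \<open>k\<close>-algebra homomorphism induced by the
  homomorphism \<open>\<sigma>\<close> of the semigroups.
\<close>

definition semigroup_ring_hom ::
  "'k::comm_ring_1 itself \<Rightarrow> ('a, 'c) monoid_scheme \<Rightarrow> ('b, 'e) monoid_scheme \<Rightarrow>
   ('a \<Rightarrow> 'b) \<Rightarrow> (('a \<Rightarrow>\<^sub>0 'k) \<Rightarrow> ('b \<Rightarrow>\<^sub>0 'k)) \<Rightarrow> bool" where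
  "semigroup_ring_hom \<kappa> G H \<sigma> f \<longleftrightarrow>
     \<sigma> \<in> monoid_hom G H \<and> f \<in> algebra_hom (monoid_algebra \<kappa> G) (monoid_algebra \<kappa> H) \<and>
     (\<forall>x\<in>carrier G. f (monomial x) = monomial (\<sigma> x))"

section \<open>Gluing\<close>

definition glued_semigroup ::
  "nat \<Rightarrow> nat \<Rightarrow> ('v \<Rightarrow>\<^sub>0 nat) set \<Rightarrow> ('v \<Rightarrow>\<^sub>0 nat) set \<Rightarrow> ('v \<Rightarrow>\<^sub>0 nat) set" where
  "glued_semigroup a b S1 S2 = {multiple a x + multiple b y | x y. x \<in> S1 \<and> y \<in> S2}"

text \<open>
  The variables \<open>X_i\<close> and \<open>Y_j\<close> are indexed by \<open>Inl i\<close> and \<open>Inr j\<close>, so \<open>k[X]\<close> and \<open>k[Y]\<close>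
  are subrings of \<open>k[X, Y]\<close>.
\<close>

definition can_be_glued ::
  "'k::field itself \<Rightarrow> nat \<Rightarrow> nat \<Rightarrow> ('v \<Rightarrow>\<^sub>0 nat) set \<Rightarrow> ('v \<Rightarrow>\<^sub>0 nat) set \<Rightarrow> bool" where
  "can_be_glued \<kappa> a b S1 S2 \<longleftrightarrow> a > 0 \<and> b > 0 \<and>
     (\<exists>(n::nat) s (m::nat) t.
        generates (additive_monoid S1) (s ` {1..n}) \<and>
        generates (additive_monoid S2) (t ` {1..m}) \<and>
        (let VX = Inl ` {1..n}; VY = Inr ` {1..m};
             PX = polynomial_ring \<kappa> VX; PY = polynomial_ring \<kappa> VY;
             P = polynomial_ring \<kappa> (VX \<union> VY);
             T1 = semigroup_ring \<kappa> (multiple a ` S1);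
             T2 = semigroup_ring \<kappa> (multiple b ` S2);
             T = semigroup_ring \<kappa> (glued_semigroup a b S1 S2)
         in \<exists>\<phi>1 \<phi>2 \<phi>.
              \<phi>1 \<in> algebra_hom PX T1 \<and> \<phi>2 \<in> algebra_hom PY T2 \<and> \<phi> \<in> algebra_hom P T \<and>
              (\<forall>i\<in>{1..n}. \<phi>1 (variable (Inl i)) = monomial (multiple a (s i)) \<and>
                          \<phi> (variable (Inl i)) = monomial (multiple a (s i))) \<and>
              (\<forall>j\<in>{1..m}. \<phi>2 (variable (Inr j)) = monomial (multiple b (t j)) \<and>
                          \<phi> (variable (Inr j)) = monomial (multiple b (t j))) \<and>
              (\<exists>e\<in>exponents VX. \<exists>e'\<in>exponents VY.
                 \<phi> (monomial e) = \<phi> (monomial e') \<and> \<phi> (monomial e) \<noteq> \<one>\<^bsub>T\<^esub> \<and>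
                 a_kernel P T \<phi> =
                   genideal P (a_kernel PX T1 \<phi>1) <+>\<^bsub>P\<^esub> genideal P (a_kernel PY T2 \<phi>2)
                     <+>\<^bsub>P\<^esub> genideal P {monomial e \<ominus>\<^bsub>P\<^esub> monomial e'})))"

section \<open>Tensor products\<close>

text \<open>
  The tensor product of \<open>A\<close> and \<open>B\<close> over \<open>R\<close>, where \<open>A\<close> and \<open>B\<close> are \<open>R\<close>-algebras via ring
  homomorphisms \<open>f\<close> and \<open>g\<close>, is the free abelian group on \<open>A \<times> B\<close> modulo the usual relations.
  The free group is the additive group of the integral monoid ring of the multiplicative monoid
  of \<open>A \<times> B\<close>; multiplying a relation by a pair \<open>(c, d)\<close> gives again a relation, so the
  subgroup generated by the relations coincides with the ideal they generate.
\<close>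

definition tensor_free_ring ::
  "('k, 'a) module \<Rightarrow> ('k, 'b) module \<Rightarrow> (int, 'a \<times> 'b \<Rightarrow>\<^sub>0 int) module" where
  "tensor_free_ring A B = monoid_algebra TYPE(int) (A \<times>\<times> B)"

definition tensor_relations ::
  "('r, 'x) ring_scheme \<Rightarrow> ('k, 'a) module \<Rightarrow> ('k, 'b) module \<Rightarrow> ('r \<Rightarrow> 'a) \<Rightarrow> ('r \<Rightarrow> 'b) \<Rightarrow>
   ('a \<times> 'b \<Rightarrow>\<^sub>0 int) set" where
  "tensor_relations R A B f g = (let F = tensor_free_ring A B in
     {monomial (x \<oplus>\<^bsub>A\<^esub> x', y) \<ominus>\<^bsub>F\<^esub> (monomial (x, y) \<oplus>\<^bsub>F\<^esub> monomial (x', y)) | x x' y.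
        x \<in> carrier A \<and> x' \<in> carrier A \<and> y \<in> carrier B} \<union>
     {monomial (x, y \<oplus>\<^bsub>B\<^esub> y') \<ominus>\<^bsub>F\<^esub> (monomial (x, y) \<oplus>\<^bsub>F\<^esub> monomial (x, y')) | x y y'.
        x \<in> carrier A \<and> y \<in> carrier B \<and> y' \<in> carrier B} \<union>
     {monomial (f r \<otimes>\<^bsub>A\<^esub> x, y) \<ominus>\<^bsub>F\<^esub> monomial (x, g r \<otimes>\<^bsub>B\<^esub> y) | r x y.
        r \<in> carrier R \<and> x \<in> carrier A \<and> y \<in> carrier B})"

text \<open>
  A scalar \<open>c\<close> acts as multiplication by the class of \<open>(c \<odot> 1, 1)\<close>.
\<close>

definition tensor_product ::
  "('r, 'x) ring_scheme \<Rightarrow> ('k, 'a) module \<Rightarrow> ('k, 'b) module \<Rightarrow> ('r \<Rightarrow> 'a) \<Rightarrow> ('r \<Rightarrow> 'b) \<Rightarrow>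
   ('k, ('a \<times> 'b \<Rightarrow>\<^sub>0 int) set) module" where
  "tensor_product R A B f g =
     (let F = tensor_free_ring A B;
          I = genideal F (tensor_relations R A B f g)
      in ring.extend (F Quot I)
           (module.fields (\<lambda>c X.
              (I +>\<^bsub>F\<^esub> monomial (c \<odot>\<^bsub>A\<^esub> \<one>\<^bsub>A\<^esub>, \<one>\<^bsub>B\<^esub>)) \<otimes>\<^bsub>F Quot I\<^esub> X)))"

section \<open>Fibered sums\<close>

definition quotient_monoid :: "('a, 'c) monoid_scheme \<Rightarrow> ('a \<times> 'a) set \<Rightarrow> 'a set monoid" where
  "quotient_monoid G r =
     \<lparr>carrier = carrier G // r, mult = (\<lambda>X Y. r `` (X <#>\<^bsub>G\<^esub> Y)), one = r `` {\<one>\<^bsub>G\<^esub>}\<rparr>"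

text \<open>
  The pair \<open>(x, y)\<close> represents the formal difference \<open>x - y\<close>; the relation is the usual one
  for cancellative commutative \<open>G\<close>.
\<close>

definition difference_rel :: "('a, 'c) monoid_scheme \<Rightarrow> (('a \<times> 'a) \<times> ('a \<times> 'a)) set" where
  "difference_rel G =
     {((x, y), (x', y')) | x y x' y'. x \<in> carrier G \<and> y \<in> carrier G \<and> x' \<in> carrier G \<and>
        y' \<in> carrier G \<and> x \<otimes>\<^bsub>G\<^esub> y' = x' \<otimes>\<^bsub>G\<^esub> y}"

definition Grp :: "('a, 'c) monoid_scheme \<Rightarrow> ('a \<times> 'a) set monoid" where
  "Grp G = quotient_monoid (G \<times>\<times> G) (difference_rel G)"

definition Grp_incl :: "('a, 'c) monoid_scheme \<Rightarrow> 'a \<Rightarrow> ('a \<times> 'a) set" where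
  "Grp_incl G x = difference_rel G `` {(x, \<one>\<^bsub>G\<^esub>)}"

definition Grp_map :: "('b, 'e) monoid_scheme \<Rightarrow> ('a \<Rightarrow> 'b) \<Rightarrow> ('a \<times> 'a) set \<Rightarrow> ('b \<times> 'b) set" where
  "Grp_map H \<sigma> X = difference_rel H `` (map_prod \<sigma> \<sigma> ` X)"

definition fibered_sum ::
  "('a, 'c) monoid_scheme \<Rightarrow> ('b, 'e) monoid_scheme \<Rightarrow> ('g, 'h) monoid_scheme \<Rightarrow>
   ('a \<Rightarrow> 'b) \<Rightarrow> ('a \<Rightarrow> 'g) \<Rightarrow> (('b \<times> 'b) set \<times> ('g \<times> 'g) set) set monoid" where
  "fibered_sum S S1 S2 \<sigma>1 \<sigma>2 =
     (let D = Grp S1 \<times>\<times> Grp S2;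
          N = {(Grp_map S1 \<sigma>1 z, inv\<^bsub>Grp S2\<^esub> (Grp_map S2 \<sigma>2 z)) | z. z \<in> carrier (Grp S)}
      in (D Mod N)\<lparr>carrier := {N #>\<^bsub>D\<^esub> (Grp_incl S1 x, Grp_incl S2 y) | x y.
            x \<in> carrier S1 \<and> y \<in> carrier S2}\<rparr>)"

definition torsion_rel :: "('a, 'c) monoid_scheme \<Rightarrow> ('a \<times> 'a) set" where
  "torsion_rel G =
     {(x, y). x \<in> carrier G \<and> y \<in> carrier G \<and> (\<exists>n::nat. n > 0 \<and> x [^]\<^bsub>G\<^esub> n = y [^]\<^bsub>G\<^esub> n)}"

definition fibered_sum_mod_torsion ::
  "('a, 'c) monoid_scheme \<Rightarrow> ('b, 'e) monoid_scheme \<Rightarrow> ('g, 'h) monoid_scheme \<Rightarrow>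
   ('a \<Rightarrow> 'b) \<Rightarrow> ('a \<Rightarrow> 'g) \<Rightarrow> (('b \<times> 'b) set \<times> ('g \<times> 'g) set) set set monoid" where
  "fibered_sum_mod_torsion S S1 S2 \<sigma>1 \<sigma>2 =
     quotient_monoid (fibered_sum S S1 S2 \<sigma>1 \<sigma>2) (torsion_rel (fibered_sum S S1 S2 \<sigma>1 \<sigma>2))"

definition tensor_tilde ::
  "'k::comm_ring_1 itself \<Rightarrow> ('a, 'c) monoid_scheme \<Rightarrow> ('b, 'e) monoid_scheme \<Rightarrow>
   ('g, 'h) monoid_scheme \<Rightarrow> ('a \<Rightarrow> 'b) \<Rightarrow> ('a \<Rightarrow> 'g) \<Rightarrow>
   ('k, (('b \<times> 'b) set \<times> ('g \<times> 'g) set) set set \<Rightarrow>\<^sub>0 'k) module" where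
  "tensor_tilde \<kappa> S S1 S2 \<sigma>1 \<sigma>2 = monoid_algebra \<kappa> (fibered_sum_mod_torsion S S1 S2 \<sigma>1 \<sigma>2)"

end

theory Submission
  imports Defs "HOL-Algebra.Free_Abelian_Groups"
begin

text \<open>
  The two exponents of the gluing binomial give \<open>\<alpha> \<in> S1\<close> and \<open>\<beta> \<in> S2\<close> with
  \<open>a \<alpha> = b \<beta>\<close>, and the homomorphisms sought are \<open>t \<mapsto> u\<^sup>\<alpha>\<close> and \<open>t \<mapsto> u\<^sup>\<beta>\<close>.

  All the ideal theory of the gluing is condensed into one combinatorial fact, \<open>gluing_exchange\<close>:
  if \<open>a x + b y = a x' + b y'\<close>, then \<open>(x', y')\<close> arises from \<open>(x, y)\<close> by trading copies
  of \<open>\<alpha>\<close> in the first component for equally many copies of \<open>\<beta>\<close> in the second, or the other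
  way round. To see this, take a function \<open>c\<close> on pairs of exponents that does not change when one
  \<open>\<alpha>\<close> is traded for one \<open>\<beta>\<close>. Extended linearly, \<open>c\<close> is a functional on the polynomial ring.
  The polynomials on which all these functionals vanish form an ideal, which contains the kernels of
  \<open>\<phi>1\<close> and \<open>\<phi>2\<close> and the gluing binomial, hence the kernel of \<open>\<phi>\<close>. Monomials with equal
  image under \<open>\<phi>\<close> therefore have equal values under every \<open>c\<close>, in particular under the indicator
  function of a trading class.

  The exchange property alone makes the gluing a tensor product. The locale \<open>exchange_pushout\<close>
  treats a commutative monoid \<open>M\<close> under \<open>S1\<close> and \<open>S2\<close> that is generated by their images, in
  which the images of \<open>S\<close> agree, and whose coincidences all come from such trades. There the ring
  homomorphism from the free ring on pairs to \<open>\<kappa>[M]\<close> that sends \<open>(p, q)\<close> to the product of the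
  images of \<open>p\<close> and \<open>q\<close> is surjective, and its kernel is the ideal of tensor relations: modulo
  that ideal, every element is a sum of tensors of monomials, one for each element of \<open>M\<close>.

  The monoid \<open>a S1 + b S2\<close> has these properties by \<open>gluing_exchange\<close>. So does the fibered sum
  modulo torsion: an equality of torsion classes gives, after multiplication by some \<open>n > 0\<close> and
  cancellation, the equality \<open>a x + b y = a x' + b y'\<close>, to which \<open>gluing_exchange\<close> applies
  again. Both monoid algebras are thus isomorphic to the same tensor product.
\<close>


section \<open>Linear extension\<close>

text \<open>
  The coefficient is an argument of \<open>f\<close>, rather than a factor of its value, so that coefficients
  and values may have unrelated types: the same operation gives the weighted sums of exponent
  vectors (natural coefficients), the functionals and ring homomorphisms on \<open>\<kappa>[S]\<close>, and the
  homomorphism from the free ring behind the tensor product (integral coefficients).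
\<close>

definition lin_ext :: "('a \<Rightarrow> 'k::zero \<Rightarrow> 'b::comm_monoid_add) \<Rightarrow> ('a \<Rightarrow>\<^sub>0 'k) \<Rightarrow> 'b" where
  "lin_ext f p = (\<Sum>x\<in>Poly_Mapping.keys p. f x (Poly_Mapping.lookup p x))"

definition additive_coeffs ::
  "('a \<Rightarrow> 'k::comm_monoid_add \<Rightarrow> 'b::comm_monoid_add) \<Rightarrow> bool" where
  "additive_coeffs f \<longleftrightarrow> (\<forall>x. f x 0 = 0 \<and> (\<forall>a b. f x (a + b) = f x a + f x b))"

lemma additive_coeffsD:
  assumes "additive_coeffs f"
  shows "f x 0 = 0" "f x (a + b) = f x a + f x b"
  using assms by (auto simp: additive_coeffs_def)

lemma lin_ext_cong:
  assumes "\<And>x. x \<in> Poly_Mapping.keys p \<Longrightarrow> f x (Poly_Mapping.lookup p x) = g x (Poly_Mapping.lookup p x)"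
  shows "lin_ext f p = lin_ext g p"
  unfolding lin_ext_def using assms by (rule sum.cong[OF refl])

lemma lin_ext_superset:
  assumes "finite A" "Poly_Mapping.keys p \<subseteq> A" "\<And>x. f x 0 = 0"
  shows "lin_ext f p = (\<Sum>x\<in>A. f x (Poly_Mapping.lookup p x))"
  unfolding lin_ext_def using assms
  by (intro sum.mono_neutral_left) (auto simp: in_keys_iff)

lemma lin_ext_zero [simp]: "lin_ext f 0 = 0"
  by (simp add: lin_ext_def)

lemma lin_ext_single:
  assumes "f x 0 = 0"
  shows "lin_ext f (Poly_Mapping.single x a) = f x a"
  using assms by (simp add: lin_ext_def)

lemma lin_ext_add:
  fixes f :: "'a \<Rightarrow> 'k::comm_monoid_add \<Rightarrow> 'b::comm_monoid_add"
  assumes "additive_coeffs f"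
  shows "lin_ext f (p + q) = lin_ext f p + lin_ext f q"
proof -
  let ?A = "Poly_Mapping.keys p \<union> Poly_Mapping.keys q"
  have f: "f x 0 = 0" "f x (a + b) = f x a + f x b" for x a b
    using assms by (auto simp: additive_coeffs_def)
  have "lin_ext f r = (\<Sum>x\<in>?A. f x (Poly_Mapping.lookup r x))"
    if "Poly_Mapping.keys r \<subseteq> ?A" for r
    by (rule lin_ext_superset) (use that f in auto)
  moreover have "Poly_Mapping.keys (p + q) \<subseteq> ?A"
    by (rule Poly_Mapping.keys_add)
  ultimately show ?thesis
    by (simp add: lookup_add f sum.distrib)
qed

lemma lin_ext_sum:
  assumes "additive_coeffs f"
  shows "lin_ext f (sum g A) = (\<Sum>i\<in>A. lin_ext f (g i))"
  by (induction A rule: infinite_finite_induct) (simp_all add: lin_ext_add[OF assms])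

lemma lin_ext_lin_ext:
  assumes "additive_coeffs f"
  shows "lin_ext f (lin_ext g p) = lin_ext (\<lambda>x a. lin_ext f (g x a)) p"
  by (simp add: lin_ext_def[of g] lin_ext_sum[OF assms] lin_ext_def[of "\<lambda>x a. lin_ext f (g x a)"])

lemma additive_hom_lin_ext:
  assumes "h 0 = 0" "\<And>u v. h (u + v) = h u + h v"
  shows "h (lin_ext f p) = lin_ext (\<lambda>x a. h (f x a)) p"
  unfolding lin_ext_def
  using sum_comp_morphism[of h "\<lambda>x. f x (Poly_Mapping.lookup p x)"] assms by (simp add: comp_def)

lemma lin_ext_swap:
  "lin_ext (\<lambda>x a. lin_ext (\<lambda>y b. f x a y b) q) p = lin_ext (\<lambda>y b. lin_ext (\<lambda>x a. f x a y b) p) q"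
  unfolding lin_ext_def by (rule sum.swap)

lemma lin_ext_monomials: "lin_ext (\<lambda>x a. Poly_Mapping.single x a) p = p"
  by (rule poly_mapping_eqI)
    (auto simp: lin_ext_def lookup_sum lookup_single when_def in_keys_iff sum.delta')

lemma lin_ext_add_fun:
  "lin_ext (\<lambda>x a. f x a + g x a) p = lin_ext f p + lin_ext g p"
  by (simp add: lin_ext_def sum.distrib)

lemma lin_ext_zero_fun [simp]: "lin_ext (\<lambda>x a. 0) p = 0"
  by (simp add: lin_ext_def)

lemma keys_lin_ext:
  assumes "\<And>x. x \<in> Poly_Mapping.keys p \<Longrightarrow> Poly_Mapping.keys (f x (Poly_Mapping.lookup p x)) \<subseteq> A"
  shows "Poly_Mapping.keys (lin_ext f p) \<subseteq> A"
  unfolding lin_ext_def by (rule order.trans[OF keys_sum]) (use assms in auto)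

section \<open>Monoid algebras\<close>

lemma monoid_algebra_simps [simp]:
  "carrier (monoid_algebra \<kappa> G) = {p. Poly_Mapping.keys p \<subseteq> carrier G}"
  "\<one>\<^bsub>monoid_algebra \<kappa> G\<^esub> = monomial \<one>\<^bsub>G\<^esub>"
  "\<zero>\<^bsub>monoid_algebra \<kappa> G\<^esub> = 0"
  "p \<oplus>\<^bsub>monoid_algebra \<kappa> G\<^esub> q = p + q"
  "c \<odot>\<^bsub>monoid_algebra \<kappa> G\<^esub> p = Poly_Mapping.map ((*) c) p"
  by (simp_all add: monoid_algebra_def)

lemma lookup_scale [simp]:
  "Poly_Mapping.lookup (Poly_Mapping.map ((*) c) p) x = c * Poly_Mapping.lookup (p :: 'a \<Rightarrow>\<^sub>0 'k::mult_zero) x"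
  by (simp add: map.rep_eq when_def)

lemma scale_single:
  "Poly_Mapping.map ((*) c) (Poly_Mapping.single x a) = Poly_Mapping.single x (c * a :: 'k::mult_zero)"
  by (rule poly_mapping_eqI) (simp add: lookup_single when_def)

lemma keys_scale: "Poly_Mapping.keys (Poly_Mapping.map ((*) c) p) \<subseteq> Poly_Mapping.keys (p :: 'a \<Rightarrow>\<^sub>0 'k::mult_zero)"
  by (auto simp: in_keys_iff)

lemma monoid_algebra_mult:
  "p \<otimes>\<^bsub>monoid_algebra \<kappa> G\<^esub> q =
     lin_ext (\<lambda>x a. lin_ext (\<lambda>y b. Poly_Mapping.single (x \<otimes>\<^bsub>G\<^esub> y) (a * b)) q) p"
  by (simp add: monoid_algebra_def lin_ext_def)

lemma additive_coeffs_single: "additive_coeffs (\<lambda>x a. Poly_Mapping.single (h x) (a::'k::comm_monoid_add))"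
  by (simp add: additive_coeffs_def single_add)

lemma additive_coeffs_mult:
  "additive_coeffs (\<lambda>y b. Poly_Mapping.single (h y) (a * b::'k::comm_ring_1))"
  by (simp add: additive_coeffs_def single_add distrib_left)

lemma additive_coeffs_mult':
  "additive_coeffs (\<lambda>x a. lin_ext (\<lambda>y b. Poly_Mapping.single (h x y) (a * b::'k::comm_ring_1)) q)"
  by (simp add: additive_coeffs_def single_add distrib_right lin_ext_add_fun)

lemma monoid_algebra_mult_add:
  fixes \<kappa> :: "'k::comm_ring_1 itself"
  shows "(p + p') \<otimes>\<^bsub>monoid_algebra \<kappa> G\<^esub> q = p \<otimes>\<^bsub>monoid_algebra \<kappa> G\<^esub> q + p' \<otimes>\<^bsub>monoid_algebra \<kappa> G\<^esub> q"
    and "p \<otimes>\<^bsub>monoid_algebra \<kappa> G\<^esub> (q + q') = p \<otimes>\<^bsub>monoid_algebra \<kappa> G\<^esub> q + p \<otimes>\<^bsub>monoid_algebra \<kappa> G\<^esub> q'"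
    and "0 \<otimes>\<^bsub>monoid_algebra \<kappa> G\<^esub> q = 0"
    and "p \<otimes>\<^bsub>monoid_algebra \<kappa> G\<^esub> 0 = 0"
  by (simp_all add: monoid_algebra_mult lin_ext_add[OF additive_coeffs_mult']
      lin_ext_add[OF additive_coeffs_mult] lin_ext_add_fun)

text \<open>
  Products in a monoid algebra are nested linear extensions of products of monomials. This rule and
  the next one reduce identities between products to the case of monomials.
\<close>

lemma lin_ext_monoid_algebra_mult:
  fixes \<kappa> :: "'k::comm_ring_1 itself"
  assumes "additive_coeffs f"
  shows "lin_ext f (p \<otimes>\<^bsub>monoid_algebra \<kappa> G\<^esub> q) =
    lin_ext (\<lambda>x a. lin_ext (\<lambda>y b. f (x \<otimes>\<^bsub>G\<^esub> y) (a * b)) q) p"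
  by (simp add: monoid_algebra_mult lin_ext_lin_ext[OF assms] lin_ext_single additive_coeffsD[OF assms])

lemma mult_lin_ext:
  fixes \<kappa> :: "'k::comm_ring_1 itself"
  shows "lin_ext f p \<otimes>\<^bsub>monoid_algebra \<kappa> G\<^esub> lin_ext g q =
    lin_ext (\<lambda>x a. lin_ext (\<lambda>y b. f x a \<otimes>\<^bsub>monoid_algebra \<kappa> G\<^esub> g y b) q) p"
proof -
  have l: "lin_ext f p \<otimes>\<^bsub>monoid_algebra \<kappa> G\<^esub> r = lin_ext (\<lambda>x a. f x a \<otimes>\<^bsub>monoid_algebra \<kappa> G\<^esub> r) p" for r
    by (rule additive_hom_lin_ext) (simp_all add: monoid_algebra_mult_add)
  have r: "r \<otimes>\<^bsub>monoid_algebra \<kappa> G\<^esub> lin_ext g q = lin_ext (\<lambda>y b. r \<otimes>\<^bsub>monoid_algebra \<kappa> G\<^esub> g y b) q" for r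
    by (rule additive_hom_lin_ext) (simp_all add: monoid_algebra_mult_add)
  show ?thesis by (subst l, subst r) (rule refl)
qed

lemma monomial_mult:
  fixes \<kappa> :: "'k::comm_ring_1 itself"
  shows "Poly_Mapping.single x a \<otimes>\<^bsub>monoid_algebra \<kappa> G\<^esub> Poly_Mapping.single y b =
    Poly_Mapping.single (x \<otimes>\<^bsub>G\<^esub> y) (a * b)"
  by (simp add: monoid_algebra_mult lin_ext_single)

lemma single_mult_monoid_algebra:
  fixes \<kappa> :: "'k::comm_ring_1 itself"
  assumes "comm_monoid G" "Poly_Mapping.keys p \<subseteq> carrier G"
  shows "Poly_Mapping.single \<one>\<^bsub>G\<^esub> c \<otimes>\<^bsub>monoid_algebra \<kappa> G\<^esub> p = Poly_Mapping.map ((*) c) p"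
proof -
  interpret comm_monoid G by fact
  have "Poly_Mapping.single \<one>\<^bsub>G\<^esub> c \<otimes>\<^bsub>monoid_algebra \<kappa> G\<^esub> p
      = lin_ext (\<lambda>y b. Poly_Mapping.single (\<one>\<^bsub>G\<^esub> \<otimes>\<^bsub>G\<^esub> y) (c * b)) p"
    by (simp add: monoid_algebra_mult lin_ext_single)
  also have "\<dots> = lin_ext (\<lambda>y b. Poly_Mapping.map ((*) c) (Poly_Mapping.single y b)) p"
    by (rule lin_ext_cong) (use assms in \<open>auto simp: scale_single\<close>)
  also have "\<dots> = Poly_Mapping.map ((*) c) (lin_ext (\<lambda>y b. Poly_Mapping.single y b) p)"
    by (rule additive_hom_lin_ext[symmetric])
      (auto intro!: poly_mapping_eqI simp: lookup_add distrib_left)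
  finally show ?thesis by (simp add: lin_ext_monomials)
qed

lemma cring_monoid_algebra:
  fixes \<kappa> :: "'k::comm_ring_1 itself"
  assumes "comm_monoid G"
  shows "cring (monoid_algebra \<kappa> G)"
proof (rule cringI)
  interpret comm_monoid G by fact
  let ?R = "monoid_algebra \<kappa> G"
  have closed_add: "Poly_Mapping.keys (p + q) \<subseteq> carrier G"
    if "Poly_Mapping.keys p \<subseteq> carrier G" "Poly_Mapping.keys q \<subseteq> carrier G" for p q :: "'a \<Rightarrow>\<^sub>0 'k"
    using that Poly_Mapping.keys_add[of p q] by blast
  show "abelian_group ?R"
  proof (rule abelian_groupI)
    fix x assume "x \<in> carrier ?R"
    then have "- x \<in> carrier ?R" "- x \<oplus>\<^bsub>?R\<^esub> x = \<zero>\<^bsub>?R\<^esub>"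
      by (auto simp: in_keys_iff)
    then show "\<exists>y\<in>carrier ?R. y \<oplus>\<^bsub>?R\<^esub> x = \<zero>\<^bsub>?R\<^esub>" by blast
  qed (auto simp: closed_add add_ac dest!: subsetD[OF Poly_Mapping.keys_add])
  show "comm_monoid ?R"
  proof (rule comm_monoidI)
    fix p q r assume p: "p \<in> carrier ?R" and q: "q \<in> carrier ?R" and r: "r \<in> carrier ?R"
    show "p \<otimes>\<^bsub>?R\<^esub> q \<in> carrier ?R"
      unfolding monoid_algebra_mult
      using p q by (auto 0 3 dest!: subsetD[OF keys_lin_ext[where A = "carrier G"], rotated]
          intro!: m_closed split: if_splits)
    show "p \<otimes>\<^bsub>?R\<^esub> q = q \<otimes>\<^bsub>?R\<^esub> p"
    proof -
      have "p \<otimes>\<^bsub>?R\<^esub> q = lin_ext (\<lambda>x a. lin_ext (\<lambda>y b. Poly_Mapping.single (y \<otimes>\<^bsub>G\<^esub> x) (b * a)) q) p"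
        unfolding monoid_algebra_mult
        by (intro lin_ext_cong) (use p q in \<open>auto simp: m_comm mult.commute subset_iff\<close>)
      then show ?thesis by (simp add: monoid_algebra_mult lin_ext_swap[of _ p q])
    qed
    show "p \<otimes>\<^bsub>?R\<^esub> q \<otimes>\<^bsub>?R\<^esub> r = p \<otimes>\<^bsub>?R\<^esub> (q \<otimes>\<^bsub>?R\<^esub> r)"
      unfolding monoid_algebra_mult[of _ _ "p \<otimes>\<^bsub>?R\<^esub> q"] monoid_algebra_mult[of _ _ p "q \<otimes>\<^bsub>?R\<^esub> r"]
        lin_ext_monoid_algebra_mult[OF additive_coeffs_mult'] lin_ext_monoid_algebra_mult[OF additive_coeffs_mult]
      by (intro lin_ext_cong) (use p q r in \<open>auto simp: m_assoc mult.assoc subset_iff\<close>)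
    show "\<one>\<^bsub>?R\<^esub> \<otimes>\<^bsub>?R\<^esub> p = p"
      using p by (simp add: single_mult_monoid_algebra[OF assms])
        (auto intro!: poly_mapping_eqI)
  qed simp
qed (simp add: monoid_algebra_mult_add)

lemma monoid_algebra_minus:
  fixes \<kappa> :: "'k::comm_ring_1 itself"
  assumes "comm_monoid G" "p \<in> carrier (monoid_algebra \<kappa> G)" "q \<in> carrier (monoid_algebra \<kappa> G)"
  shows "\<ominus>\<^bsub>monoid_algebra \<kappa> G\<^esub> q = - q" "p \<ominus>\<^bsub>monoid_algebra \<kappa> G\<^esub> q = p - q"
proof -
  interpret cring "monoid_algebra \<kappa> G" by (rule cring_monoid_algebra) fact
  show "\<ominus>\<^bsub>monoid_algebra \<kappa> G\<^esub> q = - q"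
    by (rule minus_equality) (use assms(3) in auto)
  then show "p \<ominus>\<^bsub>monoid_algebra \<kappa> G\<^esub> q = p - q"
    by (simp add: a_minus_def)
qed

text \<open>
  The two coefficient rings may differ, since the rule is applied both to maps between
  \<open>\<kappa>\<close>-algebras and to a map from an integral monoid ring to a \<open>\<kappa>\<close>-algebra.
\<close>

lemma lin_ext_in_ring_hom:
  fixes \<kappa> :: "'k::comm_ring_1 itself" and \<mu> :: "'l::comm_ring_1 itself"
  assumes f: "additive_coeffs f"
    and closed: "\<And>x a. x \<in> carrier G \<Longrightarrow> f x a \<in> carrier (monoid_algebra \<mu> H)"
    and mult: "\<And>x y a b. x \<in> carrier G \<Longrightarrow> y \<in> carrier G \<Longrightarrow>
      f (x \<otimes>\<^bsub>G\<^esub> y) (a * b) = f x a \<otimes>\<^bsub>monoid_algebra \<mu> H\<^esub> f y b"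
    and one: "f \<one>\<^bsub>G\<^esub> 1 = \<one>\<^bsub>monoid_algebra \<mu> H\<^esub>"
  shows "lin_ext f \<in> ring_hom (monoid_algebra \<kappa> G) (monoid_algebra \<mu> H)"
proof (rule ring_hom_memI)
  fix p q assume p: "p \<in> carrier (monoid_algebra \<kappa> G)" and q: "q \<in> carrier (monoid_algebra \<kappa> G)"
  show "lin_ext f p \<in> carrier (monoid_algebra \<mu> H)"
    using p closed by (auto dest!: subsetD[OF keys_lin_ext[where A = "carrier H"], rotated])
  show "lin_ext f (p \<otimes>\<^bsub>monoid_algebra \<kappa> G\<^esub> q) = lin_ext f p \<otimes>\<^bsub>monoid_algebra \<mu> H\<^esub> lin_ext f q"
    unfolding lin_ext_monoid_algebra_mult[OF f] mult_lin_ext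
    by (intro lin_ext_cong mult) (use p q in auto)
qed (simp_all add: lin_ext_add[OF f] lin_ext_single additive_coeffsD[OF f] one[simplified])

definition induced :: "('a \<Rightarrow> 'b) \<Rightarrow> ('a \<Rightarrow>\<^sub>0 'k::comm_ring_1) \<Rightarrow> ('b \<Rightarrow>\<^sub>0 'k)" where
  "induced \<sigma> = lin_ext (\<lambda>x a. Poly_Mapping.single (\<sigma> x) a)"

lemma induced_single [simp]: "induced \<sigma> (Poly_Mapping.single x a) = Poly_Mapping.single (\<sigma> x) a"
  by (simp add: induced_def lin_ext_single)

lemma induced_zero [simp]: "induced \<sigma> 0 = 0"
  by (simp add: induced_def)

lemma induced_add: "induced \<sigma> (p + q) = induced \<sigma> p + induced \<sigma> q"
  by (simp add: induced_def lin_ext_add[OF additive_coeffs_single])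

lemma induced_induced: "induced \<nu> (induced \<sigma> p) = induced (\<lambda>x. \<nu> (\<sigma> x)) p"
  by (simp add: induced_def lin_ext_lin_ext[OF additive_coeffs_single] lin_ext_single)

lemma induced_cong:
  assumes "\<And>x. x \<in> Poly_Mapping.keys p \<Longrightarrow> \<sigma> x = \<tau> x"
  shows "induced \<sigma> p = induced \<tau> p"
  unfolding induced_def by (rule lin_ext_cong) (simp add: assms)

lemma monoid_homD:
  assumes "\<sigma> \<in> monoid_hom G H"
  shows "x \<in> carrier G \<Longrightarrow> \<sigma> x \<in> carrier H"
    "x \<in> carrier G \<Longrightarrow> y \<in> carrier G \<Longrightarrow> \<sigma> (x \<otimes>\<^bsub>G\<^esub> y) = \<sigma> x \<otimes>\<^bsub>H\<^esub> \<sigma> y"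
    "\<sigma> \<one>\<^bsub>G\<^esub> = \<one>\<^bsub>H\<^esub>"
  using assms by (auto simp: monoid_hom_def hom_def)

lemma induced_ring_hom:
  fixes \<kappa> :: "'k::comm_ring_1 itself"
  assumes "\<sigma> \<in> monoid_hom G H"
  shows "induced \<sigma> \<in> ring_hom (monoid_algebra \<kappa> G) (monoid_algebra \<kappa> H)"
  unfolding induced_def
  by (rule lin_ext_in_ring_hom)
    (use monoid_homD[OF assms] in \<open>auto simp: additive_coeffs_single monomial_mult split: if_splits\<close>)

lemma scale_eq_lin_ext:
  "Poly_Mapping.map ((*) (c::'k::comm_ring_1)) p = lin_ext (\<lambda>x a. Poly_Mapping.single x (c * a)) p"
proof -
  have "Poly_Mapping.map ((*) c) (lin_ext Poly_Mapping.single p)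
      = lin_ext (\<lambda>x a. Poly_Mapping.map ((*) c) (Poly_Mapping.single x a)) p"
    by (rule additive_hom_lin_ext)
      (auto intro!: poly_mapping_eqI simp: lookup_add distrib_left)
  then show ?thesis by (simp add: lin_ext_monomials scale_single)
qed

lemma induced_scale:
  "induced \<sigma> (Poly_Mapping.map ((*) c) p) = Poly_Mapping.map ((*) (c::'k::comm_ring_1)) (induced \<sigma> p)"
  by (simp add: scale_eq_lin_ext induced_def lin_ext_lin_ext[OF additive_coeffs_single]
      lin_ext_lin_ext[OF additive_coeffs_mult[of "\<lambda>x. x"]] lin_ext_single)

lemma semigroup_ring_hom_induced:
  fixes \<kappa> :: "'k::comm_ring_1 itself"
  assumes "\<sigma> \<in> monoid_hom G H"
  shows "semigroup_ring_hom \<kappa> G H \<sigma> (induced \<sigma>)"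
  using assms induced_ring_hom[OF assms, of \<kappa>]
  by (simp add: semigroup_ring_hom_def algebra_hom_def induced_scale)


section \<open>Gluing\<close>

lemma additive_monoid_simps [simp]:
  "carrier (additive_monoid S) = S"
  "x \<otimes>\<^bsub>additive_monoid S\<^esub> y = x + y"
  "\<one>\<^bsub>additive_monoid S\<^esub> = 0"
  by (simp_all add: additive_monoid_def)

lemma comm_monoid_additive_monoid:
  assumes "0 \<in> S" "\<And>x y. x \<in> S \<Longrightarrow> y \<in> S \<Longrightarrow> x + y \<in> S"
  shows "comm_monoid (additive_monoid S)"
  by (rule comm_monoidI) (use assms in \<open>auto simp: add_ac\<close>)

lemma exponents_closed:
  "0 \<in> exponents V" "x \<in> exponents V \<Longrightarrow> y \<in> exponents V \<Longrightarrow> x + y \<in> exponents V"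
  by (auto simp: exponents_def dest!: subsetD[OF Poly_Mapping.keys_add])

lemma lookup_multiple [simp]: "Poly_Mapping.lookup (multiple c e) v = c * Poly_Mapping.lookup e v"
  by (simp add: multiple_def)

lemma multiple_simps [simp]:
  "multiple 0 x = 0" "multiple c 0 = 0" "multiple (Suc 0) x = x"
  by (auto intro!: poly_mapping_eqI)

lemma multiple_add: "multiple c (x + y) = multiple c x + multiple c y"
  and multiple_add_left: "multiple (c + c') x = multiple c x + multiple c' x"
  and multiple_multiple: "multiple c (multiple c' x) = multiple (c * c') x"
  by (auto intro!: poly_mapping_eqI simp: lookup_add algebra_simps)

lemma multiple_Suc: "multiple (Suc c) x = x + multiple c x"
  using multiple_add_left[of 1 c x] by simp

lemma multiple_cancel:
  assumes "c > 0"
  shows "multiple c x = multiple c y \<longleftrightarrow> x = y"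
proof
  assume "multiple c x = multiple c y"
  then have "c * Poly_Mapping.lookup x v = c * Poly_Mapping.lookup y v" for v
    by (metis lookup_multiple)
  with assms show "x = y" by (intro poly_mapping_eqI) simp
qed simp

definition weighted_sum :: "('v \<Rightarrow> 'w \<Rightarrow>\<^sub>0 nat) \<Rightarrow> ('v \<Rightarrow>\<^sub>0 nat) \<Rightarrow> ('w \<Rightarrow>\<^sub>0 nat)" where
  "weighted_sum g = lin_ext (\<lambda>v n. multiple n (g v))"

lemma additive_coeffs_multiple: "additive_coeffs (\<lambda>v n. multiple n (g v))"
  by (simp add: additive_coeffs_def multiple_add_left)

lemma weighted_sum_simps [simp]:
  "weighted_sum g 0 = 0"
  "weighted_sum g (Poly_Mapping.single v n) = multiple n (g v)"
  by (simp_all add: weighted_sum_def lin_ext_single)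

lemma weighted_sum_add: "weighted_sum g (x + y) = weighted_sum g x + weighted_sum g y"
  by (simp add: weighted_sum_def lin_ext_add[OF additive_coeffs_multiple])

lemma weighted_sum_cong:
  assumes "e \<in> exponents V" "\<And>v. v \<in> V \<Longrightarrow> g v = h v"
  shows "weighted_sum g e = weighted_sum h e"
  unfolding weighted_sum_def by (rule lin_ext_cong) (use assms in \<open>auto simp: exponents_def\<close>)

lemma exponents_induct [consumes 1, case_names zero variable add]:
  assumes "e \<in> exponents V"
    and "P 0"
    and "\<And>v. v \<in> V \<Longrightarrow> P (Poly_Mapping.single v 1)"
    and add: "\<And>x y. x \<in> exponents V \<Longrightarrow> y \<in> exponents V \<Longrightarrow> P x \<Longrightarrow> P y \<Longrightarrow> P (x + y)"
  shows "P e"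
proof -
  define Q where "Q x \<longleftrightarrow> x \<in> exponents V \<and> P x" for x
  have Q: "Q 0" "\<And>x y. Q x \<Longrightarrow> Q y \<Longrightarrow> Q (x + y)"
    using assms by (auto simp: Q_def exponents_closed)
  have Qv: "Q (Poly_Mapping.single v n)" if "v \<in> V" for v n
  proof (induction n)
    case (Suc n)
    have "Q (Poly_Mapping.single v 1)"
      using that assms(3) by (auto simp: Q_def exponents_def)
    then have "Q (Poly_Mapping.single v 1 + Poly_Mapping.single v n)"
      using Q(2) Suc by blast
    then show ?case by (simp add: single_add[symmetric])
  qed (simp add: Q)
  have "Q (\<Sum>v\<in>A. Poly_Mapping.single v (Poly_Mapping.lookup e v))" if "finite A" "A \<subseteq> V" for A
    using that by induction (auto simp: Q Qv)
  from this[of "Poly_Mapping.keys e"] assms(1) have "Q e"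
    using lin_ext_monomials[of e] by (simp add: exponents_def lin_ext_def)
  then show ?thesis by (simp add: Q_def)
qed

lemma generates_closed:
  assumes "generates (additive_monoid S) A"
  shows "0 \<in> S" "x \<in> S \<Longrightarrow> y \<in> S \<Longrightarrow> x + y \<in> S" "A \<subseteq> S"
proof -
  have S: "S = \<Inter> {H. submonoid H (additive_monoid S) \<and> A \<subseteq> H}" and A: "A \<subseteq> S"
    using assms by (auto simp: generates_def hull_def)
  have mem: "x \<in> S \<longleftrightarrow> (\<forall>H. submonoid H (additive_monoid S) \<longrightarrow> A \<subseteq> H \<longrightarrow> x \<in> H)" for x
    by (subst (1) S) blast
  show "0 \<in> S"
    unfolding mem[of 0] using submonoid.one_closed by fastforce
  show "x + y \<in> S" if "x \<in> S" "y \<in> S"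
    unfolding mem[of "x + y"] using that mem[of x] mem[of y] submonoid.m_closed by fastforce
  show "A \<subseteq> S" by (fact A)
qed

text \<open>
  With generators indexed by variables, every element of the semigroup comes from an exponent
  vector, that is, from a monomial of the polynomial ring.
\<close>

lemma generates_weighted_sum:
  assumes "generates (additive_monoid S) A" "g ` V = A"
  shows "S = weighted_sum g ` exponents V"
proof
  have "submonoid (weighted_sum g ` exponents V) (additive_monoid S)"
  proof
    show "weighted_sum g ` exponents V \<subseteq> carrier (additive_monoid S)"
    proof
      fix x assume "x \<in> weighted_sum g ` exponents V"
      then obtain e where "e \<in> exponents V" "x = weighted_sum g e" by blast
      from this(1) have "weighted_sum g e \<in> S"
        by (induction rule: exponents_induct)
          (use assms generates_closed[OF assms(1)] in \<open>auto simp: weighted_sum_add\<close>)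
      with \<open>x = _\<close> show "x \<in> carrier (additive_monoid S)" by simp
    qed
  next
    fix x y assume "x \<in> weighted_sum g ` exponents V" "y \<in> weighted_sum g ` exponents V"
    then show "x \<otimes>\<^bsub>additive_monoid S\<^esub> y \<in> weighted_sum g ` exponents V"
      by (auto simp: weighted_sum_add[symmetric] exponents_closed)
  next
    show "\<one>\<^bsub>additive_monoid S\<^esub> \<in> weighted_sum g ` exponents V"
      by (auto intro: image_eqI[of _ _ 0] simp: exponents_closed)
  qed
  note sub = this
  moreover have "A \<subseteq> weighted_sum g ` exponents V"
    by (auto simp: assms(2)[symmetric] exponents_def intro!: image_eqI[of _ _ "Poly_Mapping.single _ 1"])
  moreover have "S = (\<lambda>H. submonoid H (additive_monoid S)) hull A"
    using assms(1) by (simp add: generates_def)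
  ultimately show "S \<subseteq> weighted_sum g ` exponents V"
    by (metis hull_minimal)
  show "weighted_sum g ` exponents V \<subseteq> S"
    using submonoid.subset[OF sub] by simp
qed

lemma algebra_hom_eq_induced:
  fixes \<kappa> :: "'k::comm_ring_1 itself"
  assumes \<phi>: "\<phi> \<in> algebra_hom (monoid_algebra \<kappa> G) (monoid_algebra \<kappa> H)"
    and m: "\<And>x. x \<in> carrier G \<Longrightarrow> \<phi> (monomial x) = monomial (\<mu> x)"
    and p: "p \<in> carrier (monoid_algebra \<kappa> G)"
  shows "\<phi> p = induced \<mu> p"
proof -
  have scale: "\<phi> (Poly_Mapping.map ((*) c) q) = Poly_Mapping.map ((*) c) (\<phi> q)"
    if "Poly_Mapping.keys q \<subseteq> carrier G" for c q
    using \<phi> that by (simp add: algebra_hom_def)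
  have zero: "\<phi> 0 = 0"
    using scale[of 0 0] by (metis (no_types, opaque_lifting) empty_subsetI keys_zero lookup_scale lookup_zero mult_zero_left poly_mapping_eqI)
  have single: "\<phi> (Poly_Mapping.single x a) = Poly_Mapping.single (\<mu> x) a" if "x \<in> carrier G" for x a
    using scale[of "monomial x" a] that by (simp add: scale_single m)
  have "\<phi> (\<Sum>x\<in>A. Poly_Mapping.single x (Poly_Mapping.lookup p x))
      = (\<Sum>x\<in>A. Poly_Mapping.single (\<mu> x) (Poly_Mapping.lookup p x))" if "finite A" "A \<subseteq> carrier G" for A
    using that
  proof induction
    case (insert x A)
    have "Poly_Mapping.single x (Poly_Mapping.lookup p x) \<in> carrier (monoid_algebra \<kappa> G)"
      using insert by auto
    moreover have "(\<Sum>x\<in>A. Poly_Mapping.single x (Poly_Mapping.lookup p x)) \<in> carrier (monoid_algebra \<kappa> G)"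
      using insert by (auto dest!: subsetD[OF keys_sum] split: if_splits)
    ultimately have "\<phi> (Poly_Mapping.single x (Poly_Mapping.lookup p x) + (\<Sum>x\<in>A. Poly_Mapping.single x (Poly_Mapping.lookup p x)))
      = \<phi> (Poly_Mapping.single x (Poly_Mapping.lookup p x)) + \<phi> (\<Sum>x\<in>A. Poly_Mapping.single x (Poly_Mapping.lookup p x))"
      using ring_hom_add[of \<phi> "monoid_algebra \<kappa> G" "monoid_algebra \<kappa> H"] \<phi> by (simp add: algebra_hom_def)
    with insert show ?case by (simp add: single)
  qed (simp add: zero)
  from this[of "Poly_Mapping.keys p"] p show ?thesis
    using lin_ext_monomials[of p] by (simp add: induced_def lin_ext_def)
qed

text \<open>
  An algebra homomorphism that sends variables to monomials is determined by those monomials; on an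
  exponent vector it acts as a weighted sum. This makes \<open>\<phi>1\<close>, \<open>\<phi>2\<close> and \<open>\<phi>\<close> explicit.
\<close>

lemma polynomial_hom_eq_induced:
  fixes \<kappa> :: "'k::comm_ring_1 itself"
  assumes \<phi>: "\<phi> \<in> algebra_hom (polynomial_ring \<kappa> V) (semigroup_ring \<kappa> T)"
    and v: "\<And>v. v \<in> V \<Longrightarrow> \<phi> (variable v) = monomial (g v)"
    and p: "p \<in> carrier (polynomial_ring \<kappa> V)"
  shows "\<phi> p = induced (weighted_sum g) p"
proof (rule algebra_hom_eq_induced[OF \<phi> _ p])
  fix e assume "e \<in> carrier (additive_monoid (exponents V))"
  then have "e \<in> exponents V" by simp
  then show "\<phi> (monomial e) = monomial (weighted_sum g e)"
  proof (induction rule: exponents_induct)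
    case zero
    then show ?case
      using ring_hom_one[of \<phi> "polynomial_ring \<kappa> V" "semigroup_ring \<kappa> T"] \<phi>
      by (simp add: algebra_hom_def)
  next
    case (variable v)
    then show ?case using v by simp
  next
    case (add x y)
    have "\<phi> (monomial x \<otimes>\<^bsub>polynomial_ring \<kappa> V\<^esub> monomial y)
        = \<phi> (monomial x) \<otimes>\<^bsub>semigroup_ring \<kappa> T\<^esub> \<phi> (monomial y)"
      using \<phi> add by (intro ring_hom_mult) (auto simp: algebra_hom_def)
    with add show ?case by (simp add: monomial_mult weighted_sum_add)
  qed
qed

lemma induced_diff: "induced \<sigma> (p - q) = induced \<sigma> p - induced \<sigma> q"
  using induced_add[of \<sigma> "p - q" q] by simp

text \<open>
  The linear functional on the monoid algebra with prescribed values on the monomials.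
\<close>

definition evaluate :: "('a \<Rightarrow> 'k) \<Rightarrow> ('a \<Rightarrow>\<^sub>0 'k::comm_ring_1) \<Rightarrow> 'k" where
  "evaluate c = lin_ext (\<lambda>x a. a * c x)"

lemma additive_coeffs_evaluate: "additive_coeffs (\<lambda>x a. a * c x :: 'k::comm_ring_1)"
  by (simp add: additive_coeffs_def distrib_right)

lemma evaluate_single [simp]: "evaluate c (Poly_Mapping.single x a) = a * c x"
  by (simp add: evaluate_def lin_ext_single)

lemma evaluate_zero [simp]: "evaluate c 0 = 0"
  by (simp add: evaluate_def)

lemma evaluate_add: "evaluate c (p + q) = evaluate c p + evaluate c q"
  by (simp add: evaluate_def lin_ext_add[OF additive_coeffs_evaluate])

lemma evaluate_minus: "evaluate c (p - q) = evaluate c p - evaluate c q"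
  using evaluate_add[of c "p - q" q] by simp

lemma evaluate_induced: "evaluate c (induced \<mu> p) = evaluate (\<lambda>x. c (\<mu> x)) p"
  by (simp add: evaluate_def induced_def lin_ext_lin_ext[OF additive_coeffs_evaluate] lin_ext_single)

lemma evaluate_cong:
  "(\<And>x. x \<in> Poly_Mapping.keys p \<Longrightarrow> c x = c' x) \<Longrightarrow> evaluate c p = evaluate c' p"
  unfolding evaluate_def by (rule lin_ext_cong) simp

lemma evaluate_mult:
  fixes \<kappa> :: "'k::comm_ring_1 itself"
  shows "evaluate c (p \<otimes>\<^bsub>monoid_algebra \<kappa> G\<^esub> q) = lin_ext (\<lambda>x a. a * evaluate (\<lambda>y. c (x \<otimes>\<^bsub>G\<^esub> y)) q) p"
proof -
  have "lin_ext (\<lambda>y b. a * b * c (x \<otimes>\<^bsub>G\<^esub> y)) q = a * evaluate (\<lambda>y. c (x \<otimes>\<^bsub>G\<^esub> y)) q" for x a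
    unfolding evaluate_def
    by (subst additive_hom_lin_ext[of "(*) a"]) (simp_all add: distrib_left mult.assoc)
  then show ?thesis
    by (simp add: evaluate_def[of c] lin_ext_monoid_algebra_mult[OF additive_coeffs_evaluate])
qed

text \<open>
  The value of \<open>c\<close> on \<open>q p\<close> is a linear combination of values on \<open>p\<close> of translates of \<open>c\<close>.
  A family of functionals closed under translation therefore has an ideal of common zeros. For
  functions constant on the classes of a congruence this ideal is the kernel of the map to the
  algebra of the quotient monoid.
\<close>

lemma ideal_common_zeros:
  fixes \<kappa> :: "'k::comm_ring_1 itself"
  assumes G: "comm_monoid G"
    and shift: "\<And>c x. c \<in> C \<Longrightarrow> x \<in> carrier G \<Longrightarrow> (\<lambda>y. c (x \<otimes>\<^bsub>G\<^esub> y)) \<in> C"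
  shows "ideal {p \<in> carrier (monoid_algebra \<kappa> G). \<forall>c\<in>C. evaluate c p = 0} (monoid_algebra \<kappa> G)"
    (is "ideal ?J ?R")
proof -
  interpret R: cring ?R by (rule cring_monoid_algebra) fact
  show ?thesis
  proof (rule idealI[OF R.ring_axioms])
    show "subgroup ?J (add_monoid ?R)"
    proof (rule group.subgroupI[OF R.add.group_axioms])
      show "?J \<noteq> {}" by (auto intro!: exI[of _ 0])
      show "inv\<^bsub>add_monoid ?R\<^esub> p \<in> ?J" if "p \<in> ?J" for p
        using that monoid_algebra_minus(1)[OF G, of p \<kappa> p] evaluate_minus[of _ 0 p]
        by (auto simp: a_inv_def)
    qed (auto simp: evaluate_add dest!: subsetD[OF Poly_Mapping.keys_add])
    have mult: "q \<otimes>\<^bsub>?R\<^esub> p \<in> ?J" if p: "p \<in> ?J" and q: "q \<in> carrier ?R" for p q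
    proof -
      have "evaluate c (q \<otimes>\<^bsub>?R\<^esub> p) = 0" if "c \<in> C" for c
      proof -
        have "evaluate c (q \<otimes>\<^bsub>?R\<^esub> p) = lin_ext (\<lambda>x a. 0) q"
          unfolding evaluate_mult by (rule lin_ext_cong) (use p q shift that in auto)
        then show ?thesis by simp
      qed
      moreover have "q \<otimes>\<^bsub>?R\<^esub> p \<in> carrier ?R" using p q by (intro R.m_closed) auto
      ultimately show ?thesis by simp
    qed
    then show "q \<otimes>\<^bsub>?R\<^esub> p \<in> ?J" "p \<otimes>\<^bsub>?R\<^esub> q \<in> ?J" if "p \<in> ?J" "q \<in> carrier ?R" for p q
      using that R.m_comm[of p q] by (metis (no_types, lifting) mem_Collect_eq)+
  qed
qed

text \<open>
  Multiplication by \<open>a\<close> is injective, so a functional depending only on the weighted sum of the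
  exponents factors through \<open>\<phi>\<close>.
\<close>

lemma kernel_evaluate:
  fixes \<kappa> :: "'k::comm_ring_1 itself"
  assumes \<phi>: "\<phi> \<in> algebra_hom (polynomial_ring \<kappa> V) (semigroup_ring \<kappa> T)"
    and v: "\<And>v. v \<in> V \<Longrightarrow> \<phi> (variable v) = monomial (multiple a (g v))"
    and a: "a > 0"
    and p: "p \<in> a_kernel (polynomial_ring \<kappa> V) (semigroup_ring \<kappa> T) \<phi>"
  shows "evaluate (\<lambda>e. c (weighted_sum g e)) p = 0"
proof -
  have p': "p \<in> carrier (polynomial_ring \<kappa> V)" "\<phi> p = 0"
    using p by (simp_all add: a_kernel_def' del: monoid_algebra_simps(1)) 
  have "weighted_sum (\<lambda>v. multiple a (g v)) e = multiple a (weighted_sum g e)" for e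
    unfolding weighted_sum_def
    by (subst additive_hom_lin_ext[of "multiple a"]) (simp_all add: multiple_add multiple_multiple mult.commute)
  then have "weighted_sum (\<lambda>v. multiple a (g v)) = (\<lambda>e. multiple a (weighted_sum g e))" by blast
  then have "induced (\<lambda>e. multiple a (weighted_sum g e)) p = 0"
    using polynomial_hom_eq_induced[OF \<phi> v p'(1)] p'(2) by simp
  then have "evaluate (\<lambda>x. c (inv_into UNIV (multiple a) x)) (induced (\<lambda>e. multiple a (weighted_sum g e)) p) = 0"
    by simp
  moreover have "inv_into UNIV (multiple a) (multiple a z) = z" for z :: "'b \<Rightarrow>\<^sub>0 nat"
    by (intro inv_f_f injI) (simp add: multiple_cancel[OF a])
  ultimately show ?thesis by (simp add: evaluate_induced)
qed


text \<open>
  The witnesses are the weighted sums \<open>\<alpha>\<close> and \<open>\<beta>\<close> of the two exponents of the gluing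
  binomial. Trading is an equivalence relation, here described symmetrically by the numbers \<open>i\<close>
  and \<open>j\<close> of trades in the two directions; because both semigroups are cancellative, only the
  difference of \<open>i\<close> and \<open>j\<close> matters, and a single number \<open>k\<close> remains.
\<close>

proposition gluing_exchange:
  fixes \<kappa> :: "'k::field itself" and S1 S2 :: "('v \<Rightarrow>\<^sub>0 nat) set"
  assumes "can_be_glued \<kappa> a b S1 S2"
  shows "\<exists>\<alpha>\<in>S1. \<exists>\<beta>\<in>S2. multiple a \<alpha> = multiple b \<beta> \<and>
    (\<forall>x\<in>S1. \<forall>x'\<in>S1. \<forall>y\<in>S2. \<forall>y'\<in>S2.
       multiple a x + multiple b y = multiple a x' + multiple b y' \<longrightarrow>
       (\<exists>k. (x' = multiple k \<alpha> + x \<and> y = multiple k \<beta> + y') \<or>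
            (x = multiple k \<alpha> + x' \<and> y' = multiple k \<beta> + y)))"
proof -
  from assms obtain n s m t \<phi>1 \<phi>2 \<phi> e e' where ab: "a > 0" "b > 0"
    and s: "generates (additive_monoid S1) (s ` {1..n::nat})"
    and t: "generates (additive_monoid S2) (t ` {1..m::nat})"
    and \<phi>1: "\<phi>1 \<in> algebra_hom (polynomial_ring \<kappa> (Inl ` {1..n} :: (nat + nat) set)) (semigroup_ring \<kappa> (multiple a ` S1))"
    and \<phi>2: "\<phi>2 \<in> algebra_hom (polynomial_ring \<kappa> (Inr ` {1..m} :: (nat + nat) set)) (semigroup_ring \<kappa> (multiple b ` S2))"
    and \<phi>: "\<phi> \<in> algebra_hom (polynomial_ring \<kappa> (Inl ` {1..n} \<union> Inr ` {1..m})) (semigroup_ring \<kappa> (glued_semigroup a b S1 S2))"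
    and vs: "\<forall>i\<in>{1..n}. \<phi>1 (variable (Inl i)) = monomial (multiple a (s i)) \<and>
                          \<phi> (variable (Inl i)) = monomial (multiple a (s i))"
    and vt: "\<forall>j\<in>{1..m}. \<phi>2 (variable (Inr j)) = monomial (multiple b (t j)) \<and>
                          \<phi> (variable (Inr j)) = monomial (multiple b (t j))"
    and e: "e \<in> exponents (Inl ` {1..n})" and e': "e' \<in> exponents (Inr ` {1..m})"
    and ee': "\<phi> (monomial e) = \<phi> (monomial e')"
    and ker: "a_kernel (polynomial_ring \<kappa> (Inl ` {1..n} \<union> Inr ` {1..m})) (semigroup_ring \<kappa> (glued_semigroup a b S1 S2)) \<phi> =
       genideal (polynomial_ring \<kappa> (Inl ` {1..n} \<union> Inr ` {1..m}))
         (a_kernel (polynomial_ring \<kappa> (Inl ` {1..n})) (semigroup_ring \<kappa> (multiple a ` S1)) \<phi>1)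
       <+>\<^bsub>polynomial_ring \<kappa> (Inl ` {1..n} \<union> Inr ` {1..m})\<^esub>
       genideal (polynomial_ring \<kappa> (Inl ` {1..n} \<union> Inr ` {1..m}))
         (a_kernel (polynomial_ring \<kappa> (Inr ` {1..m})) (semigroup_ring \<kappa> (multiple b ` S2)) \<phi>2)
       <+>\<^bsub>polynomial_ring \<kappa> (Inl ` {1..n} \<union> Inr ` {1..m})\<^esub>
       genideal (polynomial_ring \<kappa> (Inl ` {1..n} \<union> Inr ` {1..m}))
         {monomial e \<ominus>\<^bsub>polynomial_ring \<kappa> (Inl ` {1..n} \<union> Inr ` {1..m})\<^esub> monomial e'}"
    unfolding can_be_glued_def Let_def by blast
  define VX :: "(nat + nat) set" where "VX = Inl ` {1..n}"
  define VY :: "(nat + nat) set" where "VY = Inr ` {1..m}"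
  note ker = ker[folded VX_def VY_def] and \<phi> = \<phi>[folded VX_def VY_def]
    and \<phi>1 = \<phi>1[folded VX_def] and \<phi>2 = \<phi>2[folded VY_def]
    and e = e[folded VX_def] and e' = e'[folded VY_def]
  let ?V = "VX \<union> VY"
  let ?P = "polynomial_ring \<kappa> ?V"
  have V: "exponents VX \<subseteq> exponents ?V" "exponents VY \<subseteq> exponents ?V"
    by (auto simp: exponents_def)
  define gX :: "nat + nat \<Rightarrow> _" where "gX = case_sum s (\<lambda>_. 0)"
  define gY :: "nat + nat \<Rightarrow> _" where "gY = case_sum (\<lambda>_. 0) t"
  define X where "X = weighted_sum gX"
  define Y where "Y = weighted_sum gY"
  have S1: "S1 = X ` exponents VX" unfolding X_def
    by (rule generates_weighted_sum[OF s]) (auto simp: gX_def VX_def image_image)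
  have S2: "S2 = Y ` exponents VY" unfolding Y_def
    by (rule generates_weighted_sum[OF t]) (auto simp: gY_def VY_def image_image)
  have zero: "weighted_sum (\<lambda>_. 0) e = 0" for e :: "nat + nat \<Rightarrow>\<^sub>0 nat"
    by (simp add: weighted_sum_def)
  have X0: "X e = 0" if "e \<in> exponents VY" for e
    unfolding X_def by (subst weighted_sum_cong[OF that, of _ "\<lambda>_. 0"]) (auto simp: gX_def VY_def zero)
  have Y0: "Y e = 0" if "e \<in> exponents VX" for e
    unfolding Y_def by (subst weighted_sum_cong[OF that, of _ "\<lambda>_. 0"]) (auto simp: gY_def VX_def zero)
  have weights: "weighted_sum (\<lambda>v. multiple a (gX v) + multiple b (gY v)) e = multiple a (X e) + multiple b (Y e)" for e
    using additive_hom_lin_ext[of "multiple a" "\<lambda>v n. multiple n (gX v)" e]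
      additive_hom_lin_ext[of "multiple b" "\<lambda>v n. multiple n (gY v)" e]
    by (simp add: weighted_sum_def X_def Y_def multiple_add multiple_multiple lin_ext_add_fun mult.commute)
  have \<phi>_eq: "\<phi> p = induced (\<lambda>e. multiple a (X e) + multiple b (Y e)) p" if "p \<in> carrier ?P" for p
    unfolding weights[symmetric]
    by (rule polynomial_hom_eq_induced[OF \<phi> _ that])
      (use vs vt in \<open>auto simp: VX_def VY_def gX_def gY_def\<close>)
  have \<phi>_monomial: "\<phi> (monomial e) = monomial (multiple a (X e) + multiple b (Y e))" if "e \<in> exponents ?V" for e
    using that by (subst \<phi>_eq) auto
  have inj: "x = y" if "(monomial x :: ('v \<Rightarrow>\<^sub>0 nat) \<Rightarrow>\<^sub>0 'k) = monomial y" for x y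
    using arg_cong[OF that, of Poly_Mapping.keys] by simp
  define \<alpha> where "\<alpha> = X e"
  define \<beta> where "\<beta> = Y e'"
  have \<alpha>\<beta>: "\<alpha> \<in> S1" "\<beta> \<in> S2" "multiple a \<alpha> = multiple b \<beta>"
    using e e' ee' V by (auto simp: \<alpha>_def \<beta>_def S1 S2 \<phi>_monomial X0 Y0 subset_iff dest!: inj)
  have "\<exists>k. (x' = multiple k \<alpha> + x \<and> y = multiple k \<beta> + y') \<or>
            (x = multiple k \<alpha> + x' \<and> y' = multiple k \<beta> + y)"
    if xy: "x \<in> S1" "x' \<in> S1" "y \<in> S2" "y' \<in> S2"
      and eq: "multiple a x + multiple b y = multiple a x' + multiple b y'" for x x' y y'
  proof -
    \<comment> \<open>the functions of the two weighted sums that are invariant under trading \<open>\<alpha>\<close> for \<open>\<beta>\<close>\<close>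
    define C where "C = {\<lambda>e. c (X e) (Y e) | c :: ('v \<Rightarrow>\<^sub>0 nat) \<Rightarrow> ('v \<Rightarrow>\<^sub>0 nat) \<Rightarrow> 'k.
      \<forall>u v. c (\<alpha> + u) v = c u (\<beta> + v)}"
    define J where "J = {p \<in> carrier ?P. \<forall>c\<in>C. evaluate c p = 0}"
    have P: "comm_monoid (additive_monoid (exponents ?V))"
      by (intro comm_monoid_additive_monoid exponents_closed)
    interpret P: cring ?P by (rule cring_monoid_algebra[OF P])
    have "ideal J ?P" unfolding J_def
    proof (rule ideal_common_zeros[OF P])
      fix c z assume "c \<in> C"
      then obtain c' where c': "c = (\<lambda>e. c' (X e) (Y e))" "\<forall>u v. c' (\<alpha> + u) v = c' u (\<beta> + v)"
        by (auto simp: C_def)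
      show "(\<lambda>e. c (z \<otimes>\<^bsub>additive_monoid (exponents ?V)\<^esub> e)) \<in> C"
        unfolding C_def
        by (rule CollectI, rule exI[of _ "\<lambda>u v. c' (X z + u) (Y z + v)"])
          (use c' in \<open>simp add: X_def Y_def weighted_sum_add add.left_commute\<close>)
    qed
    interpret J: ideal J ?P by fact
    have "a_kernel (polynomial_ring \<kappa> VX) (semigroup_ring \<kappa> (multiple a ` S1)) \<phi>1 \<subseteq> J"
    proof
      fix p assume p: "p \<in> a_kernel (polynomial_ring \<kappa> VX) (semigroup_ring \<kappa> (multiple a ` S1)) \<phi>1"
      have k: "Poly_Mapping.keys p \<subseteq> exponents VX" using p by (simp add: a_kernel_def')
      have "evaluate c p = 0" if "c \<in> C" for c
      proof -
        from that obtain c' where c': "c = (\<lambda>e. c' (X e) (Y e))" by (auto simp: C_def)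
        have "evaluate c p = evaluate (\<lambda>e. c' (X e) 0) p"
          by (rule evaluate_cong) (use k in \<open>auto simp: c' Y0\<close>)
        also have "\<dots> = 0" unfolding X_def
          by (rule kernel_evaluate[OF \<phi>1 _ ab(1) p]) (use vs in \<open>auto simp: VX_def gX_def\<close>)
        finally show ?thesis .
      qed
      with k V show "p \<in> J" by (auto simp: J_def)
    qed
    moreover have "a_kernel (polynomial_ring \<kappa> VY) (semigroup_ring \<kappa> (multiple b ` S2)) \<phi>2 \<subseteq> J"
    proof
      fix p assume p: "p \<in> a_kernel (polynomial_ring \<kappa> VY) (semigroup_ring \<kappa> (multiple b ` S2)) \<phi>2"
      have k: "Poly_Mapping.keys p \<subseteq> exponents VY" using p by (simp add: a_kernel_def')
      have "evaluate c p = 0" if "c \<in> C" for c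
      proof -
        from that obtain c' where c': "c = (\<lambda>e. c' (X e) (Y e))" by (auto simp: C_def)
        have "evaluate c p = evaluate (\<lambda>e. c' 0 (Y e)) p"
          by (rule evaluate_cong) (use k in \<open>auto simp: c' X0\<close>)
        also have "\<dots> = 0" unfolding Y_def
          by (rule kernel_evaluate[OF \<phi>2 _ ab(2) p]) (use vt in \<open>auto simp: VY_def gY_def\<close>)
        finally show ?thesis .
      qed
      with k V show "p \<in> J" by (auto simp: J_def)
    qed
    moreover have "monomial e \<ominus>\<^bsub>?P\<^esub> monomial e' \<in> J"
    proof -
      have mem: "monomial e \<in> carrier ?P" "monomial e' \<in> carrier ?P"
        using e e' V by auto
      have "evaluate c (monomial e - monomial e') = 0" if "c \<in> C" for c
      proof -
        from that obtain c' where c': "c = (\<lambda>e. c' (X e) (Y e))" "\<forall>u v. c' (\<alpha> + u) v = c' u (\<beta> + v)"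
          by (auto simp: C_def)
        from c'(2)[rule_format, of 0 0] e e' show ?thesis
          by (simp add: evaluate_minus c'(1) X0 Y0 \<alpha>_def \<beta>_def)
      qed
      moreover have "monomial e \<ominus>\<^bsub>?P\<^esub> monomial e' \<in> carrier ?P" using mem by (rule P.minus_closed)
      ultimately show ?thesis
        using monoid_algebra_minus(2)[OF P mem] by (simp add: J_def)
    qed
    moreover have sum_subset: "A <+>\<^bsub>?P\<^esub> B \<subseteq> J" if "A \<subseteq> J" "B \<subseteq> J" for A B
      using that J.a_closed unfolding set_add_def' by blast
    ultimately have "a_kernel ?P (semigroup_ring \<kappa> (glued_semigroup a b S1 S2)) \<phi> \<subseteq> J"
      unfolding ker by (intro sum_subset P.genideal_minimal[OF \<open>ideal J ?P\<close>]) auto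
    moreover obtain u v u' v' where uv: "u \<in> exponents VX" "x = X u" "u' \<in> exponents VX" "x' = X u'"
      "v \<in> exponents VY" "y = Y v" "v' \<in> exponents VY" "y' = Y v'"
      using xy S1 S2 by blast
    define p where "p = (monomial (u + v) :: (nat + nat \<Rightarrow>\<^sub>0 nat) \<Rightarrow>\<^sub>0 'k) - monomial (u' + v')"
    have X': "X (u + v) = x" "X (u' + v') = x'" and Y': "Y (u + v) = y" "Y (u' + v') = y'"
      using uv X0 Y0 by (simp_all add: X_def Y_def weighted_sum_add)
    have uvV: "u + v \<in> exponents ?V" "u' + v' \<in> exponents ?V"
      using uv V by (auto intro!: exponents_closed)
    then have mem: "(monomial (u + v) :: _ \<Rightarrow>\<^sub>0 'k) \<in> carrier ?P" "(monomial (u' + v') :: _ \<Rightarrow>\<^sub>0 'k) \<in> carrier ?P"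
      by auto
    have p: "p \<in> carrier ?P"
      using P.minus_closed[OF mem] unfolding monoid_algebra_minus(2)[OF P mem] p_def .
    have "\<phi> p = 0"
      unfolding \<phi>_eq[OF p] unfolding p_def induced_diff
      by (simp add: X' Y' eq)
    then have "p \<in> a_kernel ?P (semigroup_ring \<kappa> (glued_semigroup a b S1 S2)) \<phi>"
      using p by (simp add: a_kernel_def')
    ultimately have "p \<in> J" by blast
    \<comment> \<open>the indicator function of the trading class of \<open>(x', y')\<close>\<close>
    define c :: "('v \<Rightarrow>\<^sub>0 nat) \<Rightarrow> ('v \<Rightarrow>\<^sub>0 nat) \<Rightarrow> 'k" where
      "c u v = (if \<exists>i j. multiple i \<alpha> + u = multiple j \<alpha> + x' \<and> multiple j \<beta> + v = multiple i \<beta> + y'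
                then 1 else 0)" for u v
    have "c (\<alpha> + u) v = c u (\<beta> + v)" for u v
    proof -
      have "(\<exists>i j. multiple i \<alpha> + (\<alpha> + u) = multiple j \<alpha> + x' \<and> multiple j \<beta> + v = multiple i \<beta> + y') \<longleftrightarrow>
        (\<exists>i j. multiple i \<alpha> + u = multiple j \<alpha> + x' \<and> multiple j \<beta> + (\<beta> + v) = multiple i \<beta> + y')" (is "?L \<longleftrightarrow> ?R")
      proof
        assume ?L
        then obtain i j where "multiple i \<alpha> + (\<alpha> + u) = multiple j \<alpha> + x'" "multiple j \<beta> + v = multiple i \<beta> + y'"
          by blast
        then have "multiple (i + 1) \<alpha> + u = multiple j \<alpha> + x' \<and> multiple j \<beta> + (\<beta> + v) = multiple (i + 1) \<beta> + y'"
          by (simp add: multiple_Suc add.assoc add.left_commute)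
        then show ?R by blast
      next
        assume ?R
        then obtain i j where "multiple i \<alpha> + u = multiple j \<alpha> + x'" "multiple j \<beta> + (\<beta> + v) = multiple i \<beta> + y'"
          by blast
        then have "multiple i \<alpha> + (\<alpha> + u) = multiple (j + 1) \<alpha> + x' \<and> multiple (j + 1) \<beta> + v = multiple i \<beta> + y'"
          by (simp add: multiple_Suc add.assoc add.left_commute)
        then show ?L by blast
      qed
      then show ?thesis by (simp add: c_def)
    qed
    then have "(\<lambda>e. c (X e) (Y e)) \<in> C" by (auto simp: C_def)
    with \<open>p \<in> J\<close> have "evaluate (\<lambda>e. c (X e) (Y e)) p = 0" by (auto simp: J_def)
    then have "c x y = c x' y'"
      by (simp add: p_def evaluate_minus X' Y')
    moreover have "c x' y' = 1" by (auto simp: c_def)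
    ultimately obtain i j where ij: "multiple i \<alpha> + x = multiple j \<alpha> + x'" "multiple j \<beta> + y = multiple i \<beta> + y'"
      by (auto simp: c_def split: if_splits)
    show ?thesis
    proof (cases "i \<le> j")
      case True
      have j: "multiple j z = multiple i z + multiple (j - i) z" for z :: "'v \<Rightarrow>\<^sub>0 nat"
        using True by (simp add: multiple_add_left[symmetric])
      have "x = multiple (j - i) \<alpha> + x'" "y' = multiple (j - i) \<beta> + y"
        using ij unfolding j by (simp_all add: add.assoc)
      then show ?thesis by blast
    next
      case False
      have i: "multiple i z = multiple j z + multiple (i - j) z" for z :: "'v \<Rightarrow>\<^sub>0 nat"
        using False by (simp add: multiple_add_left[symmetric])
      have "x' = multiple (i - j) \<alpha> + x" "y = multiple (i - j) \<beta> + y'"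
        using ij unfolding i by (simp_all add: add.assoc)
      then show ?thesis by blast
    qed
  qed
  with \<alpha>\<beta> show ?thesis by blast
qed


section \<open>Tensor products of monoid algebras\<close>

lemma comm_monoid_DirProd:
  assumes "comm_monoid G" "comm_monoid H"
  shows "comm_monoid (G \<times>\<times> H)"
proof -
  interpret G: comm_monoid G by fact
  interpret H: comm_monoid H by fact
  show ?thesis
    by (rule comm_monoidI) (auto simp: G.m_assoc H.m_assoc intro: G.m_comm H.m_comm)
qed

lemma poly_mapping_induct_on [consumes 1, case_names zero single add]:
  fixes p :: "'a \<Rightarrow>\<^sub>0 'k::comm_monoid_add"
  assumes "Poly_Mapping.keys p \<subseteq> A"
    and "P 0"
    and "\<And>x a. x \<in> A \<Longrightarrow> P (Poly_Mapping.single x a)"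
    and "\<And>p q. Poly_Mapping.keys p \<subseteq> A \<Longrightarrow> Poly_Mapping.keys q \<subseteq> A \<Longrightarrow> P p \<Longrightarrow> P q \<Longrightarrow> P (p + q)"
  shows "P p"
proof -
  have "Poly_Mapping.keys (\<Sum>x\<in>B. Poly_Mapping.single x (Poly_Mapping.lookup p x)) \<subseteq> A \<and>
      P (\<Sum>x\<in>B. Poly_Mapping.single x (Poly_Mapping.lookup p x))" if "finite B" "B \<subseteq> A" for B
    using that
  proof induction
    case (insert x B)
    then have "Poly_Mapping.keys (Poly_Mapping.single x (Poly_Mapping.lookup p x)) \<subseteq> A" by simp
    with insert show ?case
      using Poly_Mapping.keys_add[of "Poly_Mapping.single x (Poly_Mapping.lookup p x)"
          "\<Sum>x\<in>B. Poly_Mapping.single x (Poly_Mapping.lookup p x)"]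
      by (auto intro!: assms)
  qed (simp add: assms)
  from this[of "Poly_Mapping.keys p"] assms(1) show ?thesis
    using lin_ext_monomials[of p] by (simp add: lin_ext_def)
qed

text \<open>
  For families that are additive only modulo a subgroup \<open>I\<close>, such as tensors of monomials modulo
  the tensor relations. As \<open>f x 0\<close> lies in \<open>I\<close> but may be nonzero, extending the range of
  summation beyond the support changes the sum by an element of \<open>I\<close>.
\<close>

lemma lin_ext_add_modulo:
  fixes f :: "'a \<Rightarrow> 'k::comm_monoid_add \<Rightarrow> 'b::ab_group_add"
  assumes I: "0 \<in> I" "\<And>u v. u \<in> I \<Longrightarrow> v \<in> I \<Longrightarrow> u + v \<in> I" "\<And>u. u \<in> I \<Longrightarrow> - u \<in> I"
    and f: "\<And>x a b. x \<in> A \<Longrightarrow> f x (a + b) - (f x a + f x b) \<in> I"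
    and A: "Poly_Mapping.keys p \<subseteq> A" "Poly_Mapping.keys q \<subseteq> A"
  shows "lin_ext f (p + q) - (lin_ext f p + lin_ext f q) \<in> I"
proof -
  let ?B = "Poly_Mapping.keys p \<union> Poly_Mapping.keys q"
  let ?s = "\<lambda>r. \<Sum>x\<in>?B. f x (Poly_Mapping.lookup r x)"
  have sum: "(\<Sum>x\<in>X. g x) \<in> I" if "\<And>x. x \<in> X \<Longrightarrow> g x \<in> I" for g and X :: "'a set"
    using that by (induction X rule: infinite_finite_induct) (auto simp: I)
  have f0: "f x 0 \<in> I" if "x \<in> A" for x
    using I(3)[OF f[OF that, of 0 0]] by simp
  have s: "?s r - lin_ext f r \<in> I" if "Poly_Mapping.keys r \<subseteq> ?B" for r
  proof -
    have "?s r = (\<Sum>x\<in>?B - Poly_Mapping.keys r. f x (Poly_Mapping.lookup r x)) + lin_ext f r"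
      unfolding lin_ext_def using that by (intro sum.subset_diff) auto
    moreover have "(\<Sum>x\<in>?B - Poly_Mapping.keys r. f x (Poly_Mapping.lookup r x)) \<in> I"
      by (rule sum) (use A f0 in \<open>auto simp: in_keys_iff\<close>)
    ultimately show ?thesis by simp
  qed
  have "?s (p + q) - (?s p + ?s q) = (\<Sum>x\<in>?B. f x (Poly_Mapping.lookup (p + q) x)
      - (f x (Poly_Mapping.lookup p x) + f x (Poly_Mapping.lookup q x)))"
    by (simp add: sum.distrib sum_subtractf)
  also have "\<dots> \<in> I"
    by (rule sum) (use A f in \<open>auto simp: lookup_add\<close>)
  finally have *: "?s (p + q) - (?s p + ?s q) \<in> I" .
  have "lin_ext f (p + q) - (lin_ext f p + lin_ext f q) =
      (?s (p + q) - (?s p + ?s q)) + (- (?s (p + q) - lin_ext f (p + q)) + ((?s p - lin_ext f p) + (?s q - lin_ext f q)))"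
    by simp
  also have "\<dots> \<in> I"
    by (intro I * s Poly_Mapping.keys_add) auto
  finally show ?thesis .
qed

lemma tensor_product_simps:
  fixes R A B f g
  defines "F \<equiv> tensor_free_ring A B"
  defines "I \<equiv> genideal F (tensor_relations R A B f g)"
  shows "carrier (tensor_product R A B f g) = carrier (F Quot I)"
    "(\<otimes>\<^bsub>tensor_product R A B f g\<^esub>) = (\<otimes>\<^bsub>F Quot I\<^esub>)"
    "(\<oplus>\<^bsub>tensor_product R A B f g\<^esub>) = (\<oplus>\<^bsub>F Quot I\<^esub>)"
    "\<one>\<^bsub>tensor_product R A B f g\<^esub> = \<one>\<^bsub>F Quot I\<^esub>"
    "c \<odot>\<^bsub>tensor_product R A B f g\<^esub> Z = (I +>\<^bsub>F\<^esub> monomial (c \<odot>\<^bsub>A\<^esub> \<one>\<^bsub>A\<^esub>, \<one>\<^bsub>B\<^esub>)) \<otimes>\<^bsub>F Quot I\<^esub> Z"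
  by (simp_all add: tensor_product_def Let_def ring.defs module.defs F_def I_def)

lemma coset_in_FactRing:
  assumes "ideal I R" "x \<in> carrier R"
  shows "I +>\<^bsub>R\<^esub> x \<in> carrier (R Quot I)"
proof -
  interpret ideal I R by fact
  show ?thesis using a_rcosetsI[OF a_subset assms(2)] by (simp add: FactRing_def)
qed

text \<open>
  The last assumption says that two products \<open>\<nu>1 x \<nu>2 y\<close> coincide only if the pairs differ by
  moving the image of a single element of \<open>S\<close> from one factor to the other. In general a chain of
  such moves in both directions would be needed; one move is enough in the situations considered
  below, where \<open>S\<close> is the additive monoid of natural numbers and \<open>S1\<close> and \<open>S2\<close> are cancellative.
\<close>

locale exchange_pushout =
  fixes \<kappa> :: "'k::comm_ring_1 itself"
    and S :: "'s monoid" and S1 :: "'a monoid" and S2 :: "'b monoid" and M :: "'m monoid"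
    and \<sigma>1 \<sigma>2 \<nu>1 \<nu>2
  assumes S: "comm_monoid S" and S1: "comm_monoid S1" and S2: "comm_monoid S2" and M: "comm_monoid M"
    and \<sigma>1: "\<sigma>1 \<in> monoid_hom S S1" and \<sigma>2: "\<sigma>2 \<in> monoid_hom S S2"
    and \<nu>1: "\<nu>1 \<in> monoid_hom S1 M" and \<nu>2: "\<nu>2 \<in> monoid_hom S2 M"
    and commute: "\<And>s. s \<in> carrier S \<Longrightarrow> \<nu>1 (\<sigma>1 s) = \<nu>2 (\<sigma>2 s)"
    and generate: "carrier M \<subseteq> {\<nu>1 x \<otimes>\<^bsub>M\<^esub> \<nu>2 y | x y. x \<in> carrier S1 \<and> y \<in> carrier S2}"
    and exchange: "\<And>x y x' y'. x \<in> carrier S1 \<Longrightarrow> y \<in> carrier S2 \<Longrightarrow> x' \<in> carrier S1 \<Longrightarrow> y' \<in> carrier S2 \<Longrightarrow>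
      \<nu>1 x \<otimes>\<^bsub>M\<^esub> \<nu>2 y = \<nu>1 x' \<otimes>\<^bsub>M\<^esub> \<nu>2 y' \<Longrightarrow>
      \<exists>s\<in>carrier S. (x' = \<sigma>1 s \<otimes>\<^bsub>S1\<^esub> x \<and> y = \<sigma>2 s \<otimes>\<^bsub>S2\<^esub> y') \<or>
                   (x = \<sigma>1 s \<otimes>\<^bsub>S1\<^esub> x' \<and> y' = \<sigma>2 s \<otimes>\<^bsub>S2\<^esub> y)"
begin

abbreviation "R \<equiv> monoid_algebra \<kappa> S"
abbreviation "R1 \<equiv> monoid_algebra \<kappa> S1"
abbreviation "R2 \<equiv> monoid_algebra \<kappa> S2"
abbreviation "T \<equiv> monoid_algebra \<kappa> M"
abbreviation "F \<equiv> tensor_free_ring R1 R2"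
abbreviation "relations \<equiv> tensor_relations R R1 R2 (induced \<sigma>1) (induced \<sigma>2)"
abbreviation "I \<equiv> genideal F relations"
abbreviation pure_tensor :: "('a \<Rightarrow>\<^sub>0 'k) \<Rightarrow> ('b \<Rightarrow>\<^sub>0 'k) \<Rightarrow> (('a \<Rightarrow>\<^sub>0 'k) \<times> ('b \<Rightarrow>\<^sub>0 'k) \<Rightarrow>\<^sub>0 int)" where
  "pure_tensor p q \<equiv> monomial (p, q)"

text \<open>
  The ring homomorphism sending the pair \<open>(p, q)\<close> to the product of the images of \<open>p\<close> and \<open>q\<close>
  in \<open>\<kappa>[M]\<close>.
\<close>

definition \<Phi> :: "(('a \<Rightarrow>\<^sub>0 'k) \<times> ('b \<Rightarrow>\<^sub>0 'k) \<Rightarrow>\<^sub>0 int) \<Rightarrow> ('m \<Rightarrow>\<^sub>0 'k)" where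
  "\<Phi> = lin_ext (\<lambda>z n. Poly_Mapping.map ((*) (of_int n)) (induced \<nu>1 (fst z) \<otimes>\<^bsub>T\<^esub> induced \<nu>2 (snd z)))"

sublocale S1: comm_monoid S1 by (rule S1)
sublocale S2: comm_monoid S2 by (rule S2)
sublocale M: comm_monoid M by (rule M)
sublocale R: cring R by (rule cring_monoid_algebra[OF S])
sublocale R1: cring R1 by (rule cring_monoid_algebra[OF S1])
sublocale R2: cring R2 by (rule cring_monoid_algebra[OF S2])
sublocale T: cring T by (rule cring_monoid_algebra[OF M])

lemma pairs: "comm_monoid (R1 \<times>\<times> R2)"
  by (intro comm_monoid_DirProd R1.comm_monoid_axioms R2.comm_monoid_axioms)

sublocale F: cring F
  unfolding tensor_free_ring_def by (rule cring_monoid_algebra[OF pairs])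

lemma F_simps:
  "carrier F = {G. Poly_Mapping.keys G \<subseteq> carrier R1 \<times> carrier R2}"
  "G \<oplus>\<^bsub>F\<^esub> G' = G + G'" "\<zero>\<^bsub>F\<^esub> = 0" "\<one>\<^bsub>F\<^esub> = pure_tensor \<one>\<^bsub>R1\<^esub> \<one>\<^bsub>R2\<^esub>"
  by (simp_all add: tensor_free_ring_def)

lemma F_minus:
  assumes "G \<in> carrier F" "G' \<in> carrier F"
  shows "\<ominus>\<^bsub>F\<^esub> G = - G" "G \<ominus>\<^bsub>F\<^esub> G' = G - G'"
  using assms monoid_algebra_minus[OF pairs, of _ "TYPE(int)"] by (auto simp: tensor_free_ring_def)

lemma pure_tensor_mem: "p \<in> carrier R1 \<Longrightarrow> q \<in> carrier R2 \<Longrightarrow> pure_tensor p q \<in> carrier F"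
  by (simp add: F_simps)

lemma additive_coeffs_\<Phi>:
  "additive_coeffs (\<lambda>z n. Poly_Mapping.map ((*) (of_int n :: 'k)) (h z))"
  by (auto simp: additive_coeffs_def lookup_add distrib_right intro!: poly_mapping_eqI)

lemma \<Phi>_pure_tensor [simp]: "\<Phi> (pure_tensor p q) = induced \<nu>1 p \<otimes>\<^bsub>T\<^esub> induced \<nu>2 q"
  by (subst \<Phi>_def, subst lin_ext_single) (auto intro!: poly_mapping_eqI)

lemma \<Phi>_add: "\<Phi> (G + G') = \<Phi> G + \<Phi> G'"
  by (simp add: \<Phi>_def lin_ext_add[OF additive_coeffs_\<Phi>])

lemma \<Phi>_diff: "\<Phi> (G - G') = \<Phi> G - \<Phi> G'"
  using \<Phi>_add[of "G - G'" G'] by simp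

lemma induced_mem:
  "p \<in> carrier R1 \<Longrightarrow> induced \<nu>1 p \<in> carrier T" "q \<in> carrier R2 \<Longrightarrow> induced \<nu>2 q \<in> carrier T"
  using ring_hom_closed[OF induced_ring_hom[OF \<nu>1, of \<kappa>]] ring_hom_closed[OF induced_ring_hom[OF \<nu>2, of \<kappa>]]
  by blast+

lemma scale_mult:
  assumes "p \<in> carrier T" "q \<in> carrier T"
  shows "Poly_Mapping.map ((*) (a * b)) (p \<otimes>\<^bsub>T\<^esub> q) = Poly_Mapping.map ((*) a) p \<otimes>\<^bsub>T\<^esub> Poly_Mapping.map ((*) b) q"
proof -
  let ?c = "\<lambda>a::'k. Poly_Mapping.single \<one>\<^bsub>M\<^esub> a"
  have s: "Poly_Mapping.map ((*) c) r = ?c c \<otimes>\<^bsub>T\<^esub> r" if "r \<in> carrier T" for c r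
    using that by (simp add: single_mult_monoid_algebra[OF M])
  have c: "?c c \<in> carrier T" for c by simp
  have "Poly_Mapping.map ((*) (a * b)) (p \<otimes>\<^bsub>T\<^esub> q) = ?c (a * b) \<otimes>\<^bsub>T\<^esub> (p \<otimes>\<^bsub>T\<^esub> q)"
    by (rule s[OF T.m_closed[OF assms]])
  also have "?c (a * b) = ?c a \<otimes>\<^bsub>T\<^esub> ?c b" by (simp add: monomial_mult)
  also have "?c a \<otimes>\<^bsub>T\<^esub> ?c b \<otimes>\<^bsub>T\<^esub> (p \<otimes>\<^bsub>T\<^esub> q) = (?c a \<otimes>\<^bsub>T\<^esub> p) \<otimes>\<^bsub>T\<^esub> (?c b \<otimes>\<^bsub>T\<^esub> q)"
    using assms c by (simp only: T.m_ac T.m_closed)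
  finally show ?thesis using assms by (simp only: s)
qed

lemma \<Phi>_ring_hom: "\<Phi> \<in> ring_hom F T"
  unfolding \<Phi>_def tensor_free_ring_def
proof (rule lin_ext_in_ring_hom[OF additive_coeffs_\<Phi>])
  let ?f = "\<lambda>z n. Poly_Mapping.map ((*) (of_int n)) (induced \<nu>1 (fst z) \<otimes>\<^bsub>T\<^esub> induced \<nu>2 (snd z))"
  show "?f z n \<in> carrier T" if "z \<in> carrier (R1 \<times>\<times> R2)" for z n
  proof -
    have "induced \<nu>1 (fst z) \<otimes>\<^bsub>T\<^esub> induced \<nu>2 (snd z) \<in> carrier T"
      using that by (intro T.m_closed induced_mem) (auto simp: DirProd_def)
    then show ?thesis using keys_scale by fastforce
  qed
  show "?f (z \<otimes>\<^bsub>R1 \<times>\<times> R2\<^esub> z') (n * n') = ?f z n \<otimes>\<^bsub>T\<^esub> ?f z' n'"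
    if "z \<in> carrier (R1 \<times>\<times> R2)" "z' \<in> carrier (R1 \<times>\<times> R2)" for z z' n n'
  proof -
    obtain p q p' q' where z: "z = (p, q)" "z' = (p', q')" by (metis surj_pair)
    have mem: "p \<in> carrier R1" "q \<in> carrier R2" "p' \<in> carrier R1" "q' \<in> carrier R2"
      using that z by (auto simp: DirProd_def)
    note ind = induced_mem(1)[OF mem(1)] induced_mem(2)[OF mem(2)] induced_mem(1)[OF mem(3)] induced_mem(2)[OF mem(4)]
    have "induced \<nu>1 (p \<otimes>\<^bsub>R1\<^esub> p') \<otimes>\<^bsub>T\<^esub> induced \<nu>2 (q \<otimes>\<^bsub>R2\<^esub> q')
      = (induced \<nu>1 p \<otimes>\<^bsub>T\<^esub> induced \<nu>2 q) \<otimes>\<^bsub>T\<^esub> (induced \<nu>1 p' \<otimes>\<^bsub>T\<^esub> induced \<nu>2 q')"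
      using ind by (simp only: ring_hom_mult[OF induced_ring_hom[OF \<nu>1] mem(1,3)]
        ring_hom_mult[OF induced_ring_hom[OF \<nu>2] mem(2,4)] T.m_ac T.m_closed)
    moreover have "induced \<nu>1 p \<otimes>\<^bsub>T\<^esub> induced \<nu>2 q \<in> carrier T" "induced \<nu>1 p' \<otimes>\<^bsub>T\<^esub> induced \<nu>2 q' \<in> carrier T"
      using ind by (auto simp only: T.m_closed)
    ultimately show ?thesis
      by (simp only: z mult_DirProd fst_conv snd_conv of_int_mult scale_mult)
  qed
  show "?f \<one>\<^bsub>R1 \<times>\<times> R2\<^esub> 1 = \<one>\<^bsub>T\<^esub>"
    by (simp add: DirProd_def monoid_homD[OF \<nu>1] monoid_homD[OF \<nu>2] monomial_mult scale_single)
qed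

sublocale \<Phi>: ring_hom_ring F T \<Phi>
  by (intro ring_hom_ringI2 F.ring_axioms T.ring_axioms \<Phi>_ring_hom)

lemma relations_subset: "relations \<subseteq> carrier F"
proof -
  have mem: "induced \<sigma>1 r \<in> carrier R1" "induced \<sigma>2 r \<in> carrier R2" if "r \<in> carrier R" for r
    using ring_hom_closed[OF induced_ring_hom[OF \<sigma>1, of \<kappa>] that] ring_hom_closed[OF induced_ring_hom[OF \<sigma>2, of \<kappa>] that]
    by blast+
  show ?thesis
    unfolding tensor_relations_def Let_def
    using mem
    by (auto simp del: monoid_algebra_simps
        intro!: F.minus_closed F.a_closed pure_tensor_mem R1.a_closed R2.a_closed R1.m_closed R2.m_closed)
qed

sublocale I: ideal I F
  by (rule F.genideal_ideal[OF relations_subset])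

lemma I_closed:
  "0 \<in> I" "G \<in> I \<Longrightarrow> G' \<in> I \<Longrightarrow> G + G' \<in> I" "G \<in> I \<Longrightarrow> - G \<in> I"
  "G \<in> I \<Longrightarrow> G' \<in> I \<Longrightarrow> G - G' \<in> I"
proof -
  show 0: "0 \<in> I" using I.zero_closed by (simp add: F_simps)
  show "G + G' \<in> I" if "G \<in> I" "G' \<in> I" for G G' using I.a_closed[OF that] by (simp add: F_simps)
  show "- G \<in> I" if "G \<in> I" for G
    using I.a_inv_closed[OF that] F_minus(1)[OF I.Icarr[OF that] I.Icarr[OF that]] by simp
  with \<open>\<And>G G'. G \<in> I \<Longrightarrow> G' \<in> I \<Longrightarrow> G + G' \<in> I\<close>[of G "- G'"]
  show "G - G' \<in> I" if "G \<in> I" "G' \<in> I" using that by simp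
qed

lemma I_trans: "G - G' \<in> I \<Longrightarrow> G' - G'' \<in> I \<Longrightarrow> G - G'' \<in> I"
  using I_closed(2)[of "G - G'" "G' - G''"] by simp

lemma I_sym: "G - G' \<in> I \<Longrightarrow> G' - G \<in> I"
  using I_closed(3)[of "G - G'"] by simp

lemma relations_mem:
  assumes "p \<in> carrier R1" "p' \<in> carrier R1" "q \<in> carrier R2" "q' \<in> carrier R2" "r \<in> carrier R"
  shows "pure_tensor (p + p') q - (pure_tensor p q + pure_tensor p' q) \<in> I"
    and "pure_tensor p (q + q') - (pure_tensor p q + pure_tensor p q') \<in> I"
    and "pure_tensor (induced \<sigma>1 r \<otimes>\<^bsub>R1\<^esub> p) q - pure_tensor p (induced \<sigma>2 r \<otimes>\<^bsub>R2\<^esub> q) \<in> I"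
proof -
  have sub: "relations \<subseteq> I" by (rule F.genideal_self[OF relations_subset])
  have mem: "induced \<sigma>1 r \<in> carrier R1" "induced \<sigma>2 r \<in> carrier R2"
    using ring_hom_closed[OF induced_ring_hom[OF \<sigma>1, of \<kappa>] assms(5)] ring_hom_closed[OF induced_ring_hom[OF \<sigma>2, of \<kappa>] assms(5)]
    by blast+
  have "pure_tensor (p \<oplus>\<^bsub>R1\<^esub> p') q \<ominus>\<^bsub>F\<^esub> (pure_tensor p q \<oplus>\<^bsub>F\<^esub> pure_tensor p' q) \<in> relations"
    unfolding tensor_relations_def Let_def using assms by blast
  then show "pure_tensor (p + p') q - (pure_tensor p q + pure_tensor p' q) \<in> I"
    using sub assms R1.a_closed[OF assms(1,2)] F.a_closed[OF pure_tensor_mem pure_tensor_mem, of p q p' q]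
      F_minus(2)[OF pure_tensor_mem, of "p + p'" q "pure_tensor p q + pure_tensor p' q"]
    by (auto simp: F_simps simp del: monoid_algebra_simps(1))
  have "pure_tensor p (q \<oplus>\<^bsub>R2\<^esub> q') \<ominus>\<^bsub>F\<^esub> (pure_tensor p q \<oplus>\<^bsub>F\<^esub> pure_tensor p q') \<in> relations"
    unfolding tensor_relations_def Let_def using assms by blast
  then show "pure_tensor p (q + q') - (pure_tensor p q + pure_tensor p q') \<in> I"
    using sub assms R2.a_closed[OF assms(3,4)] F.a_closed[OF pure_tensor_mem pure_tensor_mem, of p q p q']
      F_minus(2)[OF pure_tensor_mem, of p "q + q'" "pure_tensor p q + pure_tensor p q'"]
    by (auto simp: F_simps simp del: monoid_algebra_simps(1))
  have "pure_tensor (induced \<sigma>1 r \<otimes>\<^bsub>R1\<^esub> p) q \<ominus>\<^bsub>F\<^esub> pure_tensor p (induced \<sigma>2 r \<otimes>\<^bsub>R2\<^esub> q) \<in> relations"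
    unfolding tensor_relations_def Let_def using assms by blast
  then show "pure_tensor (induced \<sigma>1 r \<otimes>\<^bsub>R1\<^esub> p) q - pure_tensor p (induced \<sigma>2 r \<otimes>\<^bsub>R2\<^esub> q) \<in> I"
    using sub F_minus(2)[OF pure_tensor_mem[OF R1.m_closed[OF mem(1) assms(1)] assms(3)]
        pure_tensor_mem[OF assms(1) R2.m_closed[OF mem(2) assms(3)]]]
    by auto
qed

text \<open>
  Additivity in each variable gives the first two kinds of relations. The third kind is respected
  because \<open>\<nu>1 \<sigma>1 = \<nu>2 \<sigma>2\<close> on \<open>S\<close>.
\<close>

lemma I_subset_kernel: "I \<subseteq> a_kernel F T \<Phi>"
proof (rule F.genideal_minimal[OF \<Phi>.kernel_is_ideal])
  have \<psi>: "induced \<nu>1 (induced \<sigma>1 r) = induced \<nu>2 (induced \<sigma>2 r)" if "r \<in> carrier R" for r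
    unfolding induced_induced by (rule induced_cong) (use that commute in auto)
  have mem: "induced \<sigma>1 r \<in> carrier R1" "induced \<sigma>2 r \<in> carrier R2" if "r \<in> carrier R" for r
    using ring_hom_closed[OF induced_ring_hom[OF \<sigma>1, of \<kappa>] that] ring_hom_closed[OF induced_ring_hom[OF \<sigma>2, of \<kappa>] that]
    by blast+
  show "relations \<subseteq> a_kernel F T \<Phi>"
  proof
    fix G assume G: "G \<in> relations"
    with relations_subset have "G \<in> carrier F" by blast
    moreover have "\<Phi> G = \<zero>\<^bsub>T\<^esub>"
      using G unfolding tensor_relations_def Let_def
    proof (elim UnE CollectE exE conjE)
      fix p p' q assume G: "G = pure_tensor (p \<oplus>\<^bsub>R1\<^esub> p') q \<ominus>\<^bsub>F\<^esub> (pure_tensor p q \<oplus>\<^bsub>F\<^esub> pure_tensor p' q)"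
        and m: "p \<in> carrier R1" "p' \<in> carrier R1" "q \<in> carrier R2"
      have "G = pure_tensor (p \<oplus>\<^bsub>R1\<^esub> p') q - (pure_tensor p q \<oplus>\<^bsub>F\<^esub> pure_tensor p' q)"
        unfolding G by (intro F_minus F.a_closed pure_tensor_mem R1.a_closed m)
      then show ?thesis
        by (simp add: F_simps \<Phi>_diff \<Phi>_add induced_add monoid_algebra_mult_add)
    next
      fix p q q' assume G: "G = pure_tensor p (q \<oplus>\<^bsub>R2\<^esub> q') \<ominus>\<^bsub>F\<^esub> (pure_tensor p q \<oplus>\<^bsub>F\<^esub> pure_tensor p q')"
        and m: "p \<in> carrier R1" "q \<in> carrier R2" "q' \<in> carrier R2"
      have "G = pure_tensor p (q \<oplus>\<^bsub>R2\<^esub> q') - (pure_tensor p q \<oplus>\<^bsub>F\<^esub> pure_tensor p q')"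
        unfolding G by (intro F_minus F.a_closed pure_tensor_mem R2.a_closed m)
      then show ?thesis
        by (simp add: F_simps \<Phi>_diff \<Phi>_add induced_add monoid_algebra_mult_add)
    next
      fix r p q assume G: "G = pure_tensor (induced \<sigma>1 r \<otimes>\<^bsub>R1\<^esub> p) q \<ominus>\<^bsub>F\<^esub> pure_tensor p (induced \<sigma>2 r \<otimes>\<^bsub>R2\<^esub> q)"
        and m: "r \<in> carrier R" "p \<in> carrier R1" "q \<in> carrier R2"
      have "G = pure_tensor (induced \<sigma>1 r \<otimes>\<^bsub>R1\<^esub> p) q - pure_tensor p (induced \<sigma>2 r \<otimes>\<^bsub>R2\<^esub> q)"
        unfolding G by (intro F_minus pure_tensor_mem R1.m_closed R2.m_closed mem m)
      moreover have "induced \<nu>1 (induced \<sigma>1 r \<otimes>\<^bsub>R1\<^esub> p) \<otimes>\<^bsub>T\<^esub> induced \<nu>2 q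
          = induced \<nu>1 p \<otimes>\<^bsub>T\<^esub> induced \<nu>2 (induced \<sigma>2 r \<otimes>\<^bsub>R2\<^esub> q)"
      proof -
        note m' = induced_mem(2)[OF mem(2)[OF m(1)]] induced_mem(1)[OF m(2)] induced_mem(2)[OF m(3)]
        have "induced \<nu>1 (induced \<sigma>1 r \<otimes>\<^bsub>R1\<^esub> p) = induced \<nu>2 (induced \<sigma>2 r) \<otimes>\<^bsub>T\<^esub> induced \<nu>1 p"
          using ring_hom_mult[OF induced_ring_hom[OF \<nu>1, of \<kappa>] mem(1)[OF m(1)] m(2)] \<psi>[OF m(1)] by (simp only:)
        moreover have "induced \<nu>2 (induced \<sigma>2 r \<otimes>\<^bsub>R2\<^esub> q) = induced \<nu>2 (induced \<sigma>2 r) \<otimes>\<^bsub>T\<^esub> induced \<nu>2 q"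
          by (rule ring_hom_mult[OF induced_ring_hom[OF \<nu>2, of \<kappa>] mem(2)[OF m(1)] m(3)])
        ultimately show ?thesis
          using T.m_assoc[OF m'] T.m_lcomm[OF m'] by (simp only:)
      qed
      ultimately show ?thesis by (simp add: \<Phi>_diff)
    qed
    ultimately show "G \<in> a_kernel F T \<Phi>" unfolding a_kernel_def' by blast
  qed
qed

definition factors :: "'m \<Rightarrow> 'a \<times> 'b" where
  "factors m = (SOME (x, y). x \<in> carrier S1 \<and> y \<in> carrier S2 \<and> m = \<nu>1 x \<otimes>\<^bsub>M\<^esub> \<nu>2 y)"

abbreviation "left m \<equiv> fst (factors m)"
abbreviation "right m \<equiv> snd (factors m)"

lemma left_right:
  assumes "m \<in> carrier M"
  shows "left m \<in> carrier S1" "right m \<in> carrier S2" "\<nu>1 (left m) \<otimes>\<^bsub>M\<^esub> \<nu>2 (right m) = m"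
proof -
  let ?P = "\<lambda>(x, y). x \<in> carrier S1 \<and> y \<in> carrier S2 \<and> m = \<nu>1 x \<otimes>\<^bsub>M\<^esub> \<nu>2 y"
  obtain x y where "?P (x, y)" using subsetD[OF generate assms] by auto
  then have "\<exists>z. ?P z" by blast
  from someI_ex[OF this] show "left m \<in> carrier S1" "right m \<in> carrier S2" "\<nu>1 (left m) \<otimes>\<^bsub>M\<^esub> \<nu>2 (right m) = m"
    unfolding factors_def[symmetric] by (auto simp: case_prod_beta)
qed

text \<open>
  A right inverse of \<open>\<Phi>\<close>, built from a choice of factors of each element of \<open>M\<close>. It is
  additive only modulo the tensor relations.
\<close>

definition section_map :: "('m \<Rightarrow>\<^sub>0 'k) \<Rightarrow> (('a \<Rightarrow>\<^sub>0 'k) \<times> ('b \<Rightarrow>\<^sub>0 'k) \<Rightarrow>\<^sub>0 int)" where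
  "section_map = lin_ext (\<lambda>m a. pure_tensor (Poly_Mapping.single (left m) a) (monomial (right m)))"

lemma section_map_mem:
  assumes "r \<in> carrier T"
  shows "section_map r \<in> carrier F"
  using assms left_right unfolding section_map_def F_simps
  by (auto dest!: subsetD[OF keys_lin_ext[where A = "carrier R1 \<times> carrier R2"], rotated] split: if_splits)

lemma \<Phi>_section_map:
  assumes "r \<in> carrier T"
  shows "\<Phi> (section_map r) = r"
proof -
  have "\<Phi> (section_map r) = lin_ext (\<lambda>m a. Poly_Mapping.single (\<nu>1 (left m) \<otimes>\<^bsub>M\<^esub> \<nu>2 (right m)) a) r"
    unfolding section_map_def
    by (subst additive_hom_lin_ext[of \<Phi>]) (simp_all add: \<Phi>_add monomial_mult, simp add: \<Phi>_def)
  also have "\<dots> = lin_ext Poly_Mapping.single r"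
    by (rule lin_ext_cong) (use assms left_right in auto)
  finally show ?thesis by (simp add: lin_ext_monomials)
qed

lemma section_map_add:
  assumes "r \<in> carrier T" "r' \<in> carrier T"
  shows "section_map (r + r') - (section_map r + section_map r') \<in> I"
  unfolding section_map_def
proof (rule lin_ext_add_modulo[where A = "carrier M"])
  fix m and a b :: 'k assume "m \<in> carrier M"
  then show "pure_tensor (Poly_Mapping.single (left m) (a + b)) (monomial (right m)) -
      (pure_tensor (Poly_Mapping.single (left m) a) (monomial (right m)) +
       pure_tensor (Poly_Mapping.single (left m) b) (monomial (right m))) \<in> I"
    unfolding single_add by (intro relations_mem(1)[of _ _ _ 0 0]) (auto simp: left_right)
qed (use assms I_closed in auto)

lemma section_map_diff:
  assumes "r \<in> carrier T" "r' \<in> carrier T"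
  shows "section_map (r - r') - (section_map r - section_map r') \<in> I"
proof -
  have "r - r' \<in> carrier T"
    using T.minus_closed[OF assms] monoid_algebra_minus(2)[OF M assms] by simp
  from I_sym[OF section_map_add[OF this assms(2)]]
  show ?thesis by (simp add: algebra_simps)
qed

text \<open>
  This is where the exchange property enters. The scalar \<open>b\<close> is moved across the tensor sign, and
  then so is the element of \<open>S\<close> by which \<open>(x, y)\<close> differs from the chosen factors of the
  product; both moves are instances of the third kind of relation.
\<close>

lemma pure_tensor_single:
  assumes "x \<in> carrier S1" "y \<in> carrier S2"
  shows "pure_tensor (Poly_Mapping.single x a) (Poly_Mapping.single y b)
    - section_map (Poly_Mapping.single (\<nu>1 x \<otimes>\<^bsub>M\<^esub> \<nu>2 y) (a * b)) \<in> I"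
proof -
  define m where "m = \<nu>1 x \<otimes>\<^bsub>M\<^esub> \<nu>2 y"
  have m: "m \<in> carrier M"
    using assms monoid_homD(1)[OF \<nu>1] monoid_homD(1)[OF \<nu>2] by (simp add: m_def)
  note lr = left_right[OF m]
  have s: "section_map (Poly_Mapping.single m (a * b)) - pure_tensor (Poly_Mapping.single (left m) (a * b)) (monomial (right m)) \<in> I"
  proof (cases "a * b = 0")
    case True
    have "pure_tensor (0 + 0) (monomial (right m)) - (pure_tensor 0 (monomial (right m)) + pure_tensor 0 (monomial (right m))) \<in> I"
      by (rule relations_mem(1)[of _ _ _ 0 0]) (auto simp: lr)
    then show ?thesis using True by (simp add: section_map_def)
  next
    case False
    then show ?thesis by (simp add: section_map_def lin_ext_def I_closed)
  qed
  have "induced \<sigma>1 (Poly_Mapping.single \<one>\<^bsub>S\<^esub> b) \<otimes>\<^bsub>R1\<^esub> Poly_Mapping.single x a = Poly_Mapping.single x (a * b)"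
    "induced \<sigma>2 (Poly_Mapping.single \<one>\<^bsub>S\<^esub> b) \<otimes>\<^bsub>R2\<^esub> monomial y = Poly_Mapping.single y b"
    using assms by (simp_all add: monomial_mult monoid_homD(3)[OF \<sigma>1] monoid_homD(3)[OF \<sigma>2] mult.commute)
  with relations_mem(3)[of "Poly_Mapping.single x a" 0 "monomial y" 0 "Poly_Mapping.single \<one>\<^bsub>S\<^esub> b"] assms
  have scalar: "pure_tensor (Poly_Mapping.single x (a * b)) (monomial y)
      - pure_tensor (Poly_Mapping.single x a) (Poly_Mapping.single y b) \<in> I"
    using comm_monoid.axioms(1)[OF S] monoid.one_closed by (auto split: if_splits)
  have move: "pure_tensor (Poly_Mapping.single (\<sigma>1 s \<otimes>\<^bsub>S1\<^esub> u) c) (monomial v)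
      - pure_tensor (Poly_Mapping.single u c) (monomial (\<sigma>2 s \<otimes>\<^bsub>S2\<^esub> v)) \<in> I"
    if "s \<in> carrier S" "u \<in> carrier S1" "v \<in> carrier S2" for s u v c
    using relations_mem(3)[of "Poly_Mapping.single u c" 0 "monomial v" 0 "monomial s"] that
    by (auto simp: monomial_mult split: if_splits)
  have "pure_tensor (Poly_Mapping.single x (a * b)) (monomial y)
      - pure_tensor (Poly_Mapping.single (left m) (a * b)) (monomial (right m)) \<in> I"
  proof -
    have "\<nu>1 x \<otimes>\<^bsub>M\<^esub> \<nu>2 y = \<nu>1 (left m) \<otimes>\<^bsub>M\<^esub> \<nu>2 (right m)"
      by (simp only: lr(3) m_def[symmetric])
    from exchange[OF assms lr(1,2) this] obtain s where s: "s \<in> carrier S" and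
      "(left m = \<sigma>1 s \<otimes>\<^bsub>S1\<^esub> x \<and> y = \<sigma>2 s \<otimes>\<^bsub>S2\<^esub> right m) \<or>
       (x = \<sigma>1 s \<otimes>\<^bsub>S1\<^esub> left m \<and> right m = \<sigma>2 s \<otimes>\<^bsub>S2\<^esub> y)" by blast
    then consider "left m = \<sigma>1 s \<otimes>\<^bsub>S1\<^esub> x" "y = \<sigma>2 s \<otimes>\<^bsub>S2\<^esub> right m" |
      "x = \<sigma>1 s \<otimes>\<^bsub>S1\<^esub> left m" "right m = \<sigma>2 s \<otimes>\<^bsub>S2\<^esub> y" by blast
    then show ?thesis
    proof cases
      case 1
      show ?thesis using I_sym[OF move[OF s assms(1) lr(2), of "a * b"]] unfolding 1[symmetric] .
    next
      case 2
      show ?thesis using move[OF s lr(1) assms(2), of "a * b"] unfolding 2[symmetric] .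
    qed
  qed
  with s scalar show ?thesis
    unfolding m_def[symmetric] by (blast intro: I_trans I_sym)
qed

lemma pure_tensor_section_map:
  assumes p: "p \<in> carrier R1" and q: "q \<in> carrier R2"
  shows "pure_tensor p q - section_map (induced \<nu>1 p \<otimes>\<^bsub>T\<^esub> induced \<nu>2 q) \<in> I"
proof -
  have section_0: "section_map 0 = 0" by (simp add: section_map_def)
  have tensor_0_left: "pure_tensor 0 q \<in> I" if "q \<in> carrier R2" for q
    using I_closed(3)[OF relations_mem(1)[of 0 0 q 0 0]] that by simp
  have tensor_0_right: "pure_tensor p 0 \<in> I" if "p \<in> carrier R1" for p
    using I_closed(3)[OF relations_mem(2)[of p 0 0 0 0]] that by simp
  have combine: "G - section_map (r + r') \<in> I"
    if "G - (u + u') \<in> I" "u - section_map r \<in> I" "u' - section_map r' \<in> I" "r \<in> carrier T" "r' \<in> carrier T"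
    for G u u' r r'
  proof -
    have "(G - (u + u')) + ((u - section_map r) + (u' - section_map r')) - (section_map (r + r') - (section_map r + section_map r')) \<in> I"
      by (intro I_closed that section_map_add)
    then show ?thesis by (simp add: algebra_simps)
  qed
  have q': "pure_tensor (Poly_Mapping.single x a) q - section_map (induced \<nu>1 (Poly_Mapping.single x a) \<otimes>\<^bsub>T\<^esub> induced \<nu>2 q) \<in> I"
    if x: "x \<in> carrier S1" for x a
  proof -
    have "Poly_Mapping.keys q \<subseteq> carrier S2" using q by simp
    then show ?thesis
    proof (induction rule: poly_mapping_induct_on)
      case zero
      show ?case using tensor_0_right[of "Poly_Mapping.single x a"] x
        by (auto simp: monoid_algebra_mult_add section_0 split: if_splits)
    next
      case (single y b)
      then show ?case using pure_tensor_single[OF x single] by (simp add: monomial_mult)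
    next
      case (add q q')
      have m: "Poly_Mapping.single x a \<in> carrier R1" "q \<in> carrier R2" "q' \<in> carrier R2" using x add by auto
      show ?case
        unfolding induced_add monoid_algebra_mult_add
        by (rule combine[OF relations_mem(2)[OF m(1) R1.zero_closed m(2,3) R.zero_closed] add(3,4)])
          (intro T.m_closed induced_mem m)+
    qed
  qed
  have "Poly_Mapping.keys p \<subseteq> carrier S1" using p by simp
  then show ?thesis
  proof (induction rule: poly_mapping_induct_on)
    case zero
    show ?case using tensor_0_left[OF q]
      by (simp add: monoid_algebra_mult_add section_0)
  next
    case (single x a)
    then show ?case by (rule q')
  next
    case (add p p')
    have m: "p \<in> carrier R1" "p' \<in> carrier R1" using add by auto
    show ?case
      unfolding induced_add monoid_algebra_mult_add
      by (rule combine[OF relations_mem(1)[OF m q R2.zero_closed R.zero_closed] add(3,4)])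
        (intro T.m_closed induced_mem m q)+
  qed
qed

text \<open>
  Both sides are additive modulo the relations, so the statement reduces to pairs and further, by
  bilinearity, to pairs of monomials. It shows that the kernel of \<open>\<Phi>\<close> is no larger than \<open>I\<close>.
\<close>

lemma section_map_\<Phi>:
  assumes "G \<in> carrier F"
  shows "G - section_map (\<Phi> G) \<in> I"
proof -
  have "Poly_Mapping.keys G \<subseteq> carrier R1 \<times> carrier R2" using assms by (simp add: F_simps)
  then have "G \<in> carrier F \<and> G - section_map (\<Phi> G) \<in> I"
  proof (induction rule: frag_induction)
    case zero
    then show ?case using F.zero_closed by (simp add: F_simps \<Phi>_def section_map_def I_closed)
  next
    case (one z)
    then show ?case
      using pure_tensor_section_map pure_tensor_mem by (cases z) (auto simp del: monoid_algebra_simps)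
  next
    case (diff G G')
    then have m: "\<Phi> G \<in> carrier T" "\<Phi> G' \<in> carrier T" "G \<in> carrier F" "G' \<in> carrier F" 
      using \<Phi>.hom_closed by auto
    have "(G - section_map (\<Phi> G)) - (G' - section_map (\<Phi> G'))
        - (section_map (\<Phi> G - \<Phi> G') - (section_map (\<Phi> G) - section_map (\<Phi> G'))) \<in> I"
      using diff by (intro I_closed(4)[OF I_closed(4)] section_map_diff m) blast+
    moreover have "G - G' \<in> carrier F"
      using F.minus_closed[OF m(3,4)] F_minus(2)[OF m(3,4)] by simp
    ultimately show ?case by (simp add: \<Phi>_diff algebra_simps)
  qed
  then show ?thesis by blast
qed

lemma kernel_\<Phi>: "a_kernel F T \<Phi> = I"
proof
  show "a_kernel F T \<Phi> \<subseteq> I"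
  proof
    fix G assume "G \<in> a_kernel F T \<Phi>"
    then have "G \<in> carrier F" "\<Phi> G = 0" unfolding a_kernel_def' monoid_algebra_simps by blast+
    with section_map_\<Phi>[of G] show "G \<in> I" by (simp add: section_map_def)
  qed
qed (rule I_subset_kernel)

text \<open>
  The isomorphism is the inverse of the map induced by \<open>\<Phi>\<close> on the quotient by its kernel. It
  respects scalars because \<open>\<Phi>\<close> sends \<open>(c \<odot> 1, 1)\<close> to the scalar \<open>c\<close>.
\<close>

theorem tensor_product_isomorphic:
  "algebra_isomorphic T (tensor_product R R1 R2 (induced \<sigma>1) (induced \<sigma>2))"
proof -
  let ?Q = "F Quot I"
  let ?X = "tensor_product R R1 R2 (induced \<sigma>1) (induced \<sigma>2)"
  define k where "k = (\<lambda>X. the_elem (\<Phi> ` X))"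
  have "\<Phi> ` carrier F = carrier T"
  proof
    show "carrier T \<subseteq> \<Phi> ` carrier F"
      by (metis \<Phi>_section_map section_map_mem image_eqI subsetI)
  qed (use \<Phi>.hom_closed in blast)
  then have k: "k \<in> ring_iso ?Q T"
    using \<Phi>.FactRing_iso_set unfolding kernel_\<Phi> k_def by blast
  define h where "h = inv_into (carrier ?Q) k"
  have "ring ?Q" by (rule I.quotient_is_ring)
  then have h: "h \<in> ring_iso T ?Q" unfolding h_def by (rule ring_iso_set_sym[OF _ k])
  then have hQ: "h \<in> ring_hom T ?Q" and h_bij: "bij_betw h (carrier T) (carrier ?Q)"
    unfolding ring_iso_def by blast+
  have k_coset: "k (I +>\<^bsub>F\<^esub> G) = \<Phi> G" if "G \<in> carrier F" for G
    using \<Phi>.the_elem_simp[OF that] unfolding kernel_\<Phi> k_def .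
  note X = tensor_product_simps[of R R1 R2 "induced \<sigma>1" "induced \<sigma>2"]
  have "h \<in> ring_hom T ?X"
    using hQ by (simp only: ring_hom_def X)
  moreover have "h (c \<odot>\<^bsub>T\<^esub> r) = c \<odot>\<^bsub>?X\<^esub> h r" if "r \<in> carrier T" for c r
  proof -
    let ?G = "pure_tensor (c \<odot>\<^bsub>R1\<^esub> \<one>\<^bsub>R1\<^esub>) \<one>\<^bsub>R2\<^esub>"
    have G: "?G \<in> carrier F" by (rule pure_tensor_mem) (auto simp: scale_single)
    have \<Phi>G: "\<Phi> ?G = Poly_Mapping.single \<one>\<^bsub>M\<^esub> c"
      by (simp add: scale_single monomial_mult monoid_homD(3)[OF \<nu>1] monoid_homD(3)[OF \<nu>2])
    then have kG: "k (I +>\<^bsub>F\<^esub> ?G) = Poly_Mapping.single \<one>\<^bsub>M\<^esub> c"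
      by (simp only: k_coset[OF G])
    have mem: "I +>\<^bsub>F\<^esub> ?G \<in> carrier ?Q"
      by (rule coset_in_FactRing[OF I.is_ideal G])
    have inj: "inj_on k (carrier ?Q)"
      using k by (simp only: ring_iso_def mem_Collect_eq bij_betw_def)
    have hc: "h (Poly_Mapping.single \<one>\<^bsub>M\<^esub> c) = I +>\<^bsub>F\<^esub> ?G"
      unfolding h_def kG[symmetric] by (rule inv_into_f_f[OF inj mem])
    have "h (c \<odot>\<^bsub>T\<^esub> r) = h (Poly_Mapping.single \<one>\<^bsub>M\<^esub> c \<otimes>\<^bsub>T\<^esub> r)"
      using that by (simp add: single_mult_monoid_algebra[OF M])
    also have "\<dots> = h (Poly_Mapping.single \<one>\<^bsub>M\<^esub> c) \<otimes>\<^bsub>?Q\<^esub> h r"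
      by (rule ring_hom_mult[OF hQ _ that]) simp
    finally show ?thesis by (simp only: hc X)
  qed
  moreover have "bij_betw h (carrier T) (carrier ?X)"
    using h_bij by (simp only: X)
  ultimately show ?thesis
    unfolding algebra_isomorphic_def algebra_hom_def by blast
qed

end


section \<open>Fibered sums\<close>

lemma comm_monoid_image:
  assumes "comm_monoid G" "carrier H = h ` carrier G"
    and mult: "\<And>x y. x \<in> carrier G \<Longrightarrow> y \<in> carrier G \<Longrightarrow> h x \<otimes>\<^bsub>H\<^esub> h y = h (x \<otimes>\<^bsub>G\<^esub> y)"
    and one: "\<one>\<^bsub>H\<^esub> = h \<one>\<^bsub>G\<^esub>"
  shows "comm_monoid H"
proof -
  interpret comm_monoid G by fact
  show ?thesis
  proof (rule comm_monoidI)
    fix x y z assume "x \<in> carrier H" "y \<in> carrier H" "z \<in> carrier H"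
    then obtain x' y' z' where *: "x = h x'" "y = h y'" "z = h z'" "x' \<in> carrier G" "y' \<in> carrier G" "z' \<in> carrier G"
      using assms(2) by auto
    then show "(x \<otimes>\<^bsub>H\<^esub> y) \<otimes>\<^bsub>H\<^esub> z = x \<otimes>\<^bsub>H\<^esub> (y \<otimes>\<^bsub>H\<^esub> z)"
      by (simp add: mult m_assoc)
  qed (auto simp: assms(2) mult one intro: arg_cong[where f = h, OF m_comm])
qed

lemma mult_quotient_monoid:
  assumes r: "equiv (carrier G) r" and G: "comm_monoid G"
    and compat: "\<And>x x' y y'. (x, x') \<in> r \<Longrightarrow> (y, y') \<in> r \<Longrightarrow> (x \<otimes>\<^bsub>G\<^esub> y, x' \<otimes>\<^bsub>G\<^esub> y') \<in> r"
    and xy: "x \<in> carrier G" "y \<in> carrier G"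
  shows "(r `` {x}) \<otimes>\<^bsub>quotient_monoid G r\<^esub> (r `` {y}) = r `` {x \<otimes>\<^bsub>G\<^esub> y}"
proof -
  interpret comm_monoid G by fact
  have refl: "(x, x) \<in> r" "(y, y) \<in> r"
    using r xy by (auto simp: equiv_def refl_on_def)
  have trans: "trans r" and sym: "sym r" using r by (auto simp: equiv_def)
  have "r `` (r `` {x} <#>\<^bsub>G\<^esub> r `` {y}) = r `` {x \<otimes>\<^bsub>G\<^esub> y}"
  proof
    show "r `` (r `` {x} <#>\<^bsub>G\<^esub> r `` {y}) \<subseteq> r `` {x \<otimes>\<^bsub>G\<^esub> y}"
      using compat transD[OF trans] by (auto simp: set_mult_def) blast
    show "r `` {x \<otimes>\<^bsub>G\<^esub> y} \<subseteq> r `` (r `` {x} <#>\<^bsub>G\<^esub> r `` {y})"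
      using refl by (auto simp: set_mult_def)
  qed
  then show ?thesis by (simp add: quotient_monoid_def)
qed

lemma comm_monoid_quotient_monoid:
  assumes "equiv (carrier G) r" "comm_monoid G"
    and "\<And>x x' y y'. (x, x') \<in> r \<Longrightarrow> (y, y') \<in> r \<Longrightarrow> (x \<otimes>\<^bsub>G\<^esub> y, x' \<otimes>\<^bsub>G\<^esub> y') \<in> r"
  shows "comm_monoid (quotient_monoid G r)"
proof (rule comm_monoid_image[where h = "\<lambda>x. r `` {x}", OF assms(2)])
  show "carrier (quotient_monoid G r) = (\<lambda>x. r `` {x}) ` carrier G"
    "\<one>\<^bsub>quotient_monoid G r\<^esub> = r `` {\<one>\<^bsub>G\<^esub>}"
    by (auto simp: quotient_monoid_def quotient_def)
qed (rule mult_quotient_monoid[OF assms])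

text \<open>
  The formal difference \<open>x - y\<close> as an element of \<open>Grp G\<close>.
\<close>

definition difference :: "('a, 'c) monoid_scheme \<Rightarrow> 'a \<Rightarrow> 'a \<Rightarrow> ('a \<times> 'a) set" where
  "difference G x y = difference_rel G `` {(x, y)}"

context comm_monoid_cancel
begin

lemma difference_rel_iff:
  "((x, y), (x', y')) \<in> difference_rel G \<longleftrightarrow>
    x \<in> carrier G \<and> y \<in> carrier G \<and> x' \<in> carrier G \<and> y' \<in> carrier G \<and> x \<otimes> y' = x' \<otimes> y"
  by (auto simp: difference_rel_def)

lemma equiv_difference_rel: "equiv (carrier (G \<times>\<times> G)) (difference_rel G)"
proof (rule equivI)
  show "difference_rel G \<subseteq> carrier (G \<times>\<times> G) \<times> carrier (G \<times>\<times> G)"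
    by (auto simp: difference_rel_def)
  show "refl_on (carrier (G \<times>\<times> G)) (difference_rel G)"
    by (auto simp: refl_on_def difference_rel_iff)
  show "sym (difference_rel G)"
    by (auto simp: sym_def difference_rel_iff)
  show "trans (difference_rel G)"
  proof (rule transI)
    fix u v w assume "(u, v) \<in> difference_rel G" "(v, w) \<in> difference_rel G"
    moreover obtain a a' b b' c c' where uvw: "u = (a, a')" "v = (b, b')" "w = (c, c')"
      by (metis surj_pair)
    ultimately have m: "a \<in> carrier G" "a' \<in> carrier G" "b \<in> carrier G" "b' \<in> carrier G" "c \<in> carrier G" "c' \<in> carrier G"
      and ab: "a \<otimes> b' = b \<otimes> a'" and bc: "b \<otimes> c' = c \<otimes> b'"
      by (auto simp: difference_rel_iff)
    have "(a \<otimes> c') \<otimes> b' = (a \<otimes> b') \<otimes> c'" using m by (simp add: m_ac)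
    also have "\<dots> = (b \<otimes> c') \<otimes> a'" using m by (simp only: ab) (simp add: m_ac)
    also have "\<dots> = (c \<otimes> a') \<otimes> b'" using m by (simp only: bc) (simp add: m_ac)
    finally show "(u, w) \<in> difference_rel G"
      using r_cancel[of "a \<otimes> c'" b' "c \<otimes> a'"] m by (simp add: uvw difference_rel_iff)
  qed
qed

lemma difference_rel_mult:
  assumes "(u, u') \<in> difference_rel G" "(v, v') \<in> difference_rel G"
  shows "(u \<otimes>\<^bsub>G \<times>\<times> G\<^esub> v, u' \<otimes>\<^bsub>G \<times>\<times> G\<^esub> v') \<in> difference_rel G"
proof -
  obtain a b a' b' where u: "u = (a, b)" "u' = (a', b')" by (metis surj_pair)
  obtain c d c' d' where v: "v = (c, d)" "v' = (c', d')" by (metis surj_pair)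
  have m: "a \<in> carrier G" "b \<in> carrier G" "a' \<in> carrier G" "b' \<in> carrier G"
    "c \<in> carrier G" "d \<in> carrier G" "c' \<in> carrier G" "d' \<in> carrier G"
    and eq: "a \<otimes> b' = a' \<otimes> b" "c \<otimes> d' = c' \<otimes> d"
    using assms by (auto simp: u v difference_rel_iff)
  have "(a \<otimes> c) \<otimes> (b' \<otimes> d') = (a \<otimes> b') \<otimes> (c \<otimes> d')" using m by (simp add: m_ac)
  also have "\<dots> = (a' \<otimes> c') \<otimes> (b \<otimes> d)" using m by (simp only: eq) (simp add: m_ac)
  finally show ?thesis using m by (simp add: u v difference_rel_iff)
qed

lemma comm_monoid_square: "comm_monoid (G \<times>\<times> G)"
  by (intro comm_monoid_DirProd comm_monoid_axioms)

lemma difference_mult: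
  assumes "x \<in> carrier G" "y \<in> carrier G" "x' \<in> carrier G" "y' \<in> carrier G"
  shows "difference G x y \<otimes>\<^bsub>Grp G\<^esub> difference G x' y' = difference G (x \<otimes> x') (y \<otimes> y')"
  using mult_quotient_monoid[OF equiv_difference_rel comm_monoid_square difference_rel_mult, of "(x, y)" "(x', y')"] assms
  by (simp add: Grp_def difference_def)

lemma difference_eq_iff:
  assumes "x \<in> carrier G" "y \<in> carrier G" "x' \<in> carrier G" "y' \<in> carrier G"
  shows "difference G x y = difference G x' y' \<longleftrightarrow> x \<otimes> y' = x' \<otimes> y"
  unfolding difference_def
  by (subst eq_equiv_class_iff[OF equiv_difference_rel]) (use assms in \<open>auto simp: difference_rel_iff\<close>)

lemma carrier_Grp: "carrier (Grp G) = {difference G x y | x y. x \<in> carrier G \<and> y \<in> carrier G}"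
  by (auto simp: Grp_def quotient_monoid_def quotient_def difference_def)

lemma one_Grp: "\<one>\<^bsub>Grp G\<^esub> = difference G \<one> \<one>"
  by (simp add: Grp_def quotient_monoid_def difference_def)

lemma comm_group_Grp: "comm_group (Grp G)"
proof -
  interpret Grp: comm_monoid "Grp G"
    unfolding Grp_def
    by (rule comm_monoid_quotient_monoid[OF equiv_difference_rel comm_monoid_square difference_rel_mult])
  show ?thesis
  proof (intro comm_group.intro Grp.comm_monoid_axioms Grp.group_l_invI)
    fix z assume "z \<in> carrier (Grp G)"
    then obtain x y where z: "z = difference G x y" "x \<in> carrier G" "y \<in> carrier G"
      by (auto simp: carrier_Grp)
    then have "difference G y x \<otimes>\<^bsub>Grp G\<^esub> z = \<one>\<^bsub>Grp G\<^esub>"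
      by (simp add: difference_mult one_Grp difference_eq_iff m_comm)
    moreover have "difference G y x \<in> carrier (Grp G)" using z by (auto simp: carrier_Grp)
    ultimately show "\<exists>u\<in>carrier (Grp G). u \<otimes>\<^bsub>Grp G\<^esub> z = \<one>\<^bsub>Grp G\<^esub>" by blast
  qed
qed

lemma inv_difference:
  assumes "x \<in> carrier G" "y \<in> carrier G"
  shows "inv\<^bsub>Grp G\<^esub> difference G x y = difference G y x"
proof -
  interpret Grp: comm_group "Grp G" by (rule comm_group_Grp)
  show ?thesis
    by (rule Grp.inv_equality)
      (use assms in \<open>auto simp: difference_mult one_Grp difference_eq_iff m_comm carrier_Grp\<close>)
qed

end

lemma Grp_map_difference:
  assumes "comm_monoid_cancel G" "comm_monoid_cancel H" and \<sigma>: "\<sigma> \<in> monoid_hom G H"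
    and xy: "x \<in> carrier G" "y \<in> carrier G"
  shows "Grp_map H \<sigma> (difference G x y) = difference H (\<sigma> x) (\<sigma> y)"
proof -
  interpret G: comm_monoid_cancel G by fact
  interpret H: comm_monoid_cancel H by fact
  note \<sigma> = monoid_homD[OF \<sigma>]
  have "(x, y) \<in> difference G x y"
    using xy by (auto simp: difference_def G.difference_rel_iff)
  moreover have "difference_rel H `` {map_prod \<sigma> \<sigma> z} = difference H (\<sigma> x) (\<sigma> y)"
    if z: "z \<in> difference G x y" for z
  proof -
    obtain x' y' where z': "z = (x', y')" by (metis surj_pair)
    with z xy have m: "x' \<in> carrier G" "y' \<in> carrier G" and eq: "x \<otimes>\<^bsub>G\<^esub> y' = x' \<otimes>\<^bsub>G\<^esub> y"
      by (auto simp: difference_def G.difference_rel_iff)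
    have "\<sigma> x \<otimes>\<^bsub>H\<^esub> \<sigma> y' = \<sigma> x' \<otimes>\<^bsub>H\<^esub> \<sigma> y"
      using arg_cong[OF eq, of \<sigma>] xy m by (simp add: \<sigma>)
    then have "difference H (\<sigma> x') (\<sigma> y') = difference H (\<sigma> x) (\<sigma> y)"
      using xy m by (subst H.difference_eq_iff) (auto simp: \<sigma>)
    then show ?thesis by (simp add: z' difference_def)
  qed
  ultimately show ?thesis
    unfolding Grp_map_def by (auto simp: Image_def)
qed

lemma equiv_torsion_rel:
  fixes G (structure)
  assumes "comm_monoid G"
  shows "equiv (carrier G) (torsion_rel G)"
proof -
  interpret comm_monoid G by fact
  show ?thesis
  proof (rule equivI)
    show "torsion_rel G \<subseteq> carrier G \<times> carrier G" by (auto simp: torsion_rel_def)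
    show "refl_on (carrier G) (torsion_rel G)"
      by (auto simp: refl_on_def torsion_rel_def intro: exI[of _ 1])
    show "sym (torsion_rel G)" by (auto simp: sym_def torsion_rel_def)
    show "trans (torsion_rel G)"
    proof (rule transI)
      fix x y z assume "(x, y) \<in> torsion_rel G" "(y, z) \<in> torsion_rel G"
      then obtain n m :: nat where m: "x \<in> carrier G" "y \<in> carrier G" "z \<in> carrier G" "n > 0" "m > 0"
        and eq: "x [^] n = y [^] n" "y [^] m = z [^] m"
        by (auto simp: torsion_rel_def)
      have "x [^] (n * m) = y [^] (n * m)"
        using nat_pow_pow[of x n m] nat_pow_pow[of y n m] m eq by simp
      also have "\<dots> = z [^] (n * m)"
        using nat_pow_pow[of y m n] nat_pow_pow[of z m n] m eq by (simp add: mult.commute)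
      finally show "(x, z) \<in> torsion_rel G"
        using m by (auto simp: torsion_rel_def intro!: exI[of _ "n * m"])
    qed
  qed
qed

lemma torsion_rel_mult:
  fixes G (structure)
  assumes "comm_monoid G" "(x, x') \<in> torsion_rel G" "(y, y') \<in> torsion_rel G"
  shows "(x \<otimes>\<^bsub>G\<^esub> y, x' \<otimes>\<^bsub>G\<^esub> y') \<in> torsion_rel G"
proof -
  interpret comm_monoid G by fact
  from assms obtain n m :: nat where m: "x \<in> carrier G" "x' \<in> carrier G" "y \<in> carrier G" "y' \<in> carrier G" "n > 0" "m > 0"
    and eq: "x [^] n = x' [^] n" "y [^] m = y' [^] m"
    by (auto simp: torsion_rel_def)
  have "x [^] (n * m) = x' [^] (n * m)"
    using nat_pow_pow[of x n m] nat_pow_pow[of x' n m] m eq by simp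
  moreover have "y [^] (n * m) = y' [^] (n * m)"
    using nat_pow_pow[of y m n] nat_pow_pow[of y' m n] m eq by (simp add: mult.commute)
  ultimately have "(x \<otimes> y) [^] (n * m) = (x' \<otimes> y') [^] (n * m)"
    using m by (simp add: pow_mult_distrib m_comm)
  then show ?thesis
    using m by (auto simp: torsion_rel_def intro!: exI[of _ "n * m"])
qed

text \<open>
  The fibered sum is computed through representatives: its elements are cosets of pairs \<open>(x, y)\<close>,
  on which multiplication acts componentwise, and its torsion classes are again represented by such
  pairs. Cancellation in the semigroups makes equality of formal differences transitive.
\<close>

locale cancellative_span =
  fixes S :: "'s monoid" and S1 :: "'a monoid" and S2 :: "'b monoid" and \<sigma>1 \<sigma>2
  assumes S: "comm_monoid_cancel S" and S1: "comm_monoid_cancel S1" and S2: "comm_monoid_cancel S2"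
    and \<sigma>1: "\<sigma>1 \<in> monoid_hom S S1" and \<sigma>2: "\<sigma>2 \<in> monoid_hom S S2"
begin

sublocale S: comm_monoid_cancel S by (rule S)
sublocale S1: comm_monoid_cancel S1 by (rule S1)
sublocale S2: comm_monoid_cancel S2 by (rule S2)

abbreviation "D \<equiv> Grp S1 \<times>\<times> Grp S2"

definition "N = {(Grp_map S1 \<sigma>1 z, inv\<^bsub>Grp S2\<^esub> (Grp_map S2 \<sigma>2 z)) | z. z \<in> carrier (Grp S)}"

definition "coset x y = N #>\<^bsub>D\<^esub> (Grp_incl S1 x, Grp_incl S2 y)"

abbreviation "FS \<equiv> fibered_sum S S1 S2 \<sigma>1 \<sigma>2"
abbreviation "FT \<equiv> fibered_sum_mod_torsion S S1 S2 \<sigma>1 \<sigma>2"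

definition "torsion_class x y = torsion_rel FS `` {coset x y}"

lemma comm_group_D: "comm_group D"
  using comm_monoid_DirProd[OF comm_group.axioms(1) comm_group.axioms(1)]
    DirProd_group[OF comm_group.axioms(2) comm_group.axioms(2)] S1.comm_group_Grp S2.comm_group_Grp
  by (intro comm_group.intro) blast+

sublocale D: comm_group D by (rule comm_group_D)

lemma N_eq: "N = {(difference S1 (\<sigma>1 p) (\<sigma>1 q), difference S2 (\<sigma>2 q) (\<sigma>2 p)) | p q. p \<in> carrier S \<and> q \<in> carrier S}"
proof -
  have "Grp_map S1 \<sigma>1 (difference S p q) = difference S1 (\<sigma>1 p) (\<sigma>1 q)"
    "inv\<^bsub>Grp S2\<^esub> (Grp_map S2 \<sigma>2 (difference S p q)) = difference S2 (\<sigma>2 q) (\<sigma>2 p)"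
    if "p \<in> carrier S" "q \<in> carrier S" for p q
    using that by (simp_all add: Grp_map_difference[OF S S1 \<sigma>1] Grp_map_difference[OF S S2 \<sigma>2]
        S2.inv_difference monoid_homD[OF \<sigma>2])
  note diff = this
  show ?thesis
  proof (intro equalityI subsetI)
    fix n assume "n \<in> N"
    then obtain p q where "p \<in> carrier S" "q \<in> carrier S"
      "n = (Grp_map S1 \<sigma>1 (difference S p q), inv\<^bsub>Grp S2\<^esub> (Grp_map S2 \<sigma>2 (difference S p q)))"
      unfolding N_def S.carrier_Grp by blast
    then show "n \<in> {(difference S1 (\<sigma>1 p) (\<sigma>1 q), difference S2 (\<sigma>2 q) (\<sigma>2 p)) | p q. p \<in> carrier S \<and> q \<in> carrier S}"
      using diff by auto
  next
    fix n assume "n \<in> {(difference S1 (\<sigma>1 p) (\<sigma>1 q), difference S2 (\<sigma>2 q) (\<sigma>2 p)) | p q. p \<in> carrier S \<and> q \<in> carrier S}"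
    then obtain p q where pq: "p \<in> carrier S" "q \<in> carrier S"
      and "n = (difference S1 (\<sigma>1 p) (\<sigma>1 q), difference S2 (\<sigma>2 q) (\<sigma>2 p))" by blast
    then have "n = (Grp_map S1 \<sigma>1 (difference S p q), inv\<^bsub>Grp S2\<^esub> (Grp_map S2 \<sigma>2 (difference S p q)))"
      by (simp only: diff)
    moreover have "difference S p q \<in> carrier (Grp S)"
      using pq unfolding S.carrier_Grp by blast
    ultimately show "n \<in> N" unfolding N_def by blast
  qed
qed

lemma difference_mem_D:
  "x \<in> carrier S1 \<Longrightarrow> x' \<in> carrier S1 \<Longrightarrow> y \<in> carrier S2 \<Longrightarrow> y' \<in> carrier S2 \<Longrightarrow>
    (difference S1 x x', difference S2 y y') \<in> carrier D"
  by (auto simp: S1.carrier_Grp S2.carrier_Grp)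

lemma subgroup_N: "subgroup N D"
proof (rule D.subgroupI)
  note hom = monoid_homD[OF \<sigma>1] monoid_homD[OF \<sigma>2]
  show "N \<subseteq> carrier D"
    by (auto simp: N_eq S1.carrier_Grp S2.carrier_Grp hom) (metis hom(1) hom(4))+
  show "N \<noteq> {}" using S.one_closed unfolding N_eq by blast
  show "inv\<^bsub>D\<^esub> n \<in> N" if "n \<in> N" for n
  proof -
    from that obtain p q where n: "n = (difference S1 (\<sigma>1 p) (\<sigma>1 q), difference S2 (\<sigma>2 q) (\<sigma>2 p))"
      "p \<in> carrier S" "q \<in> carrier S" by (auto simp: N_eq)
    have "inv\<^bsub>D\<^esub> n = (difference S1 (\<sigma>1 q) (\<sigma>1 p), difference S2 (\<sigma>2 p) (\<sigma>2 q))"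
    proof -
      have "inv\<^bsub>D\<^esub> n = (inv\<^bsub>Grp S1\<^esub> difference S1 (\<sigma>1 p) (\<sigma>1 q), inv\<^bsub>Grp S2\<^esub> difference S2 (\<sigma>2 q) (\<sigma>2 p))"
        unfolding n(1)
        by (rule inv_DirProd[OF comm_group.axioms(2)[OF S1.comm_group_Grp] comm_group.axioms(2)[OF S2.comm_group_Grp]])
          (use difference_mem_D[OF hom(1)[OF n(2)] hom(1)[OF n(3)] hom(4)[OF n(3)] hom(4)[OF n(2)]] in auto)
      then show ?thesis using n hom by (simp add: S1.inv_difference S2.inv_difference)
    qed
    then show ?thesis using n by (auto simp: N_eq)
  qed
  show "n \<otimes>\<^bsub>D\<^esub> n' \<in> N" if "n \<in> N" "n' \<in> N" for n n'
  proof -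
    from that obtain p q p' q' where n: "n = (difference S1 (\<sigma>1 p) (\<sigma>1 q), difference S2 (\<sigma>2 q) (\<sigma>2 p))"
      "n' = (difference S1 (\<sigma>1 p') (\<sigma>1 q'), difference S2 (\<sigma>2 q') (\<sigma>2 p'))"
      "p \<in> carrier S" "q \<in> carrier S" "p' \<in> carrier S" "q' \<in> carrier S" by (auto simp: N_eq)
    then have "n \<otimes>\<^bsub>D\<^esub> n' = (difference S1 (\<sigma>1 (p \<otimes>\<^bsub>S\<^esub> p')) (\<sigma>1 (q \<otimes>\<^bsub>S\<^esub> q')),
        difference S2 (\<sigma>2 (q \<otimes>\<^bsub>S\<^esub> q')) (\<sigma>2 (p \<otimes>\<^bsub>S\<^esub> p')))"
      by (simp add: S1.difference_mult S2.difference_mult hom)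
    with n show ?thesis unfolding N_eq by blast
  qed
qed

lemma normal_N: "N \<lhd> D"
  by (rule D.subgroup_imp_normal[OF subgroup_N])

lemma Grp_incl_eq: "Grp_incl S1 x = difference S1 x \<one>\<^bsub>S1\<^esub>" "Grp_incl S2 y = difference S2 y \<one>\<^bsub>S2\<^esub>"
  by (simp_all add: Grp_incl_def difference_def)

lemma incl_mem: "x \<in> carrier S1 \<Longrightarrow> y \<in> carrier S2 \<Longrightarrow> (Grp_incl S1 x, Grp_incl S2 y) \<in> carrier D"
  unfolding Grp_incl_eq by (rule difference_mem_D) auto

lemma fibered_sum_simps:
  "carrier FS = {coset x y | x y. x \<in> carrier S1 \<and> y \<in> carrier S2}"
  "X \<otimes>\<^bsub>FS\<^esub> Y = X <#>\<^bsub>D\<^esub> Y"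
  "\<one>\<^bsub>FS\<^esub> = N"
  by (simp_all add: fibered_sum_def Let_def N_def coset_def FactGroup_def)

lemma coset_mult:
  assumes "x \<in> carrier S1" "y \<in> carrier S2" "x' \<in> carrier S1" "y' \<in> carrier S2"
  shows "coset x y \<otimes>\<^bsub>FS\<^esub> coset x' y' = coset (x \<otimes>\<^bsub>S1\<^esub> x') (y \<otimes>\<^bsub>S2\<^esub> y')"
  unfolding fibered_sum_simps coset_def
  using normal.rcos_sum[OF normal_N incl_mem incl_mem, of x y x' y'] assms
  by (simp add: Grp_incl_eq S1.difference_mult S2.difference_mult)

lemma coset_one: "coset \<one>\<^bsub>S1\<^esub> \<one>\<^bsub>S2\<^esub> = \<one>\<^bsub>FS\<^esub>"
  using D.coset_mult_one[OF subgroup.subset[OF subgroup_N]]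
  by (simp add: fibered_sum_simps coset_def Grp_incl_eq S1.one_Grp S2.one_Grp)

text \<open>
  The elements of \<open>N\<close> are the pairs \<open>(\<sigma>1 p - \<sigma>1 q, \<sigma>2 q - \<sigma>2 p)\<close>; the condition for two
  pairs to lie in one coset, cleared of differences, is an equation in \<open>S1\<close> and one in \<open>S2\<close>.
\<close>

lemma coset_eqD:
  assumes "x \<in> carrier S1" "y \<in> carrier S2" "x' \<in> carrier S1" "y' \<in> carrier S2"
    and "coset x y = coset x' y'"
  shows "\<exists>p\<in>carrier S. \<exists>q\<in>carrier S. x' \<otimes>\<^bsub>S1\<^esub> \<sigma>1 q = \<sigma>1 p \<otimes>\<^bsub>S1\<^esub> x \<and> y' \<otimes>\<^bsub>S2\<^esub> \<sigma>2 p = \<sigma>2 q \<otimes>\<^bsub>S2\<^esub> y"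
proof -
  note hom = monoid_homD[OF \<sigma>1] monoid_homD[OF \<sigma>2]
  have "(Grp_incl S1 x', Grp_incl S2 y') \<in> N #>\<^bsub>D\<^esub> (Grp_incl S1 x, Grp_incl S2 y)"
    by (rule D.repr_independenceD[OF subgroup_N]) (use assms incl_mem in \<open>auto simp: coset_def\<close>)
  then obtain p q where pq: "p \<in> carrier S" "q \<in> carrier S"
    and "(Grp_incl S1 x', Grp_incl S2 y') =
      (difference S1 (\<sigma>1 p) (\<sigma>1 q), difference S2 (\<sigma>2 q) (\<sigma>2 p)) \<otimes>\<^bsub>D\<^esub> (Grp_incl S1 x, Grp_incl S2 y)"
    unfolding r_coset_def N_eq by blast
  then have "difference S1 x' \<one>\<^bsub>S1\<^esub> = difference S1 (\<sigma>1 p \<otimes>\<^bsub>S1\<^esub> x) (\<sigma>1 q)"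
    "difference S2 y' \<one>\<^bsub>S2\<^esub> = difference S2 (\<sigma>2 q \<otimes>\<^bsub>S2\<^esub> y) (\<sigma>2 p)"
    using assms by (simp_all add: Grp_incl_eq S1.difference_mult S2.difference_mult hom)
  then have "x' \<otimes>\<^bsub>S1\<^esub> \<sigma>1 q = \<sigma>1 p \<otimes>\<^bsub>S1\<^esub> x" "y' \<otimes>\<^bsub>S2\<^esub> \<sigma>2 p = \<sigma>2 q \<otimes>\<^bsub>S2\<^esub> y"
    using assms pq by (simp_all add: S1.difference_eq_iff S2.difference_eq_iff hom)
  with pq show ?thesis by blast
qed

lemma coset_commute:
  assumes "s \<in> carrier S"
  shows "coset (\<sigma>1 s) \<one>\<^bsub>S2\<^esub> = coset \<one>\<^bsub>S1\<^esub> (\<sigma>2 s)"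
proof -
  note hom = monoid_homD[OF \<sigma>1] monoid_homD[OF \<sigma>2]
  let ?n = "(difference S1 (\<sigma>1 s) (\<sigma>1 \<one>\<^bsub>S\<^esub>), difference S2 (\<sigma>2 \<one>\<^bsub>S\<^esub>) (\<sigma>2 s))"
  have "?n \<in> N" using assms S.one_closed unfolding N_eq by blast
  moreover have "(Grp_incl S1 (\<sigma>1 s), Grp_incl S2 \<one>\<^bsub>S2\<^esub>) = ?n \<otimes>\<^bsub>D\<^esub> (Grp_incl S1 \<one>\<^bsub>S1\<^esub>, Grp_incl S2 (\<sigma>2 s))"
    using assms by (simp add: Grp_incl_eq S1.difference_mult S2.difference_mult hom S2.difference_eq_iff)
  ultimately have "(Grp_incl S1 (\<sigma>1 s), Grp_incl S2 \<one>\<^bsub>S2\<^esub>) \<in> N #>\<^bsub>D\<^esub> (Grp_incl S1 \<one>\<^bsub>S1\<^esub>, Grp_incl S2 (\<sigma>2 s))"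
    unfolding r_coset_def by blast
  from D.repr_independence[OF this incl_mem subgroup_N] assms
  show ?thesis by (simp add: coset_def hom)
qed

lemma comm_monoid_fibered_sum: "comm_monoid FS"
  by (rule comm_monoid_image[where h = "\<lambda>(x, y). coset x y",
        OF comm_monoid_DirProd[OF S1.comm_monoid_axioms S2.comm_monoid_axioms]])
    (auto simp: fibered_sum_simps(1) coset_mult coset_one)

sublocale FS: comm_monoid FS by (rule comm_monoid_fibered_sum)

lemma coset_pow:
  assumes "x \<in> carrier S1" "y \<in> carrier S2"
  shows "coset x y [^]\<^bsub>FS\<^esub> n = coset (x [^]\<^bsub>S1\<^esub> n) (y [^]\<^bsub>S2\<^esub> (n::nat))"
  by (induction n) (use assms in \<open>simp_all add: coset_one coset_mult\<close>)

lemma coset_mem: "x \<in> carrier S1 \<Longrightarrow> y \<in> carrier S2 \<Longrightarrow> coset x y \<in> carrier FS"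
  by (auto simp: fibered_sum_simps(1))

lemma torsion_class_mult:
  assumes "x \<in> carrier S1" "y \<in> carrier S2" "x' \<in> carrier S1" "y' \<in> carrier S2"
  shows "torsion_class x y \<otimes>\<^bsub>FT\<^esub> torsion_class x' y' = torsion_class (x \<otimes>\<^bsub>S1\<^esub> x') (y \<otimes>\<^bsub>S2\<^esub> y')"
  using mult_quotient_monoid[OF equiv_torsion_rel[OF comm_monoid_fibered_sum] comm_monoid_fibered_sum
    torsion_rel_mult[OF comm_monoid_fibered_sum] coset_mem[OF assms(1,2)] coset_mem[OF assms(3,4)]]
  unfolding torsion_class_def fibered_sum_mod_torsion_def coset_mult[OF assms] .

lemma carrier_fibered_sum_mod_torsion:
  "carrier FT = {torsion_class x y | x y. x \<in> carrier S1 \<and> y \<in> carrier S2}"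
  by (auto simp: fibered_sum_mod_torsion_def quotient_monoid_def quotient_def fibered_sum_simps(1) torsion_class_def)

lemma one_fibered_sum_mod_torsion: "\<one>\<^bsub>FT\<^esub> = torsion_class \<one>\<^bsub>S1\<^esub> \<one>\<^bsub>S2\<^esub>"
  by (simp add: fibered_sum_mod_torsion_def quotient_monoid_def torsion_class_def coset_one)

lemma comm_monoid_fibered_sum_mod_torsion: "comm_monoid FT"
  unfolding fibered_sum_mod_torsion_def
  by (rule comm_monoid_quotient_monoid[OF equiv_torsion_rel[OF comm_monoid_fibered_sum] comm_monoid_fibered_sum
    torsion_rel_mult[OF comm_monoid_fibered_sum]])

lemma torsion_class_eqD:
  assumes xy: "x \<in> carrier S1" "y \<in> carrier S2" "x' \<in> carrier S1" "y' \<in> carrier S2"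
    and eq: "torsion_class x y = torsion_class x' y'"
  shows "\<exists>n>0. \<exists>p\<in>carrier S. \<exists>q\<in>carrier S.
    (x' [^]\<^bsub>S1\<^esub> n) \<otimes>\<^bsub>S1\<^esub> \<sigma>1 q = \<sigma>1 p \<otimes>\<^bsub>S1\<^esub> (x [^]\<^bsub>S1\<^esub> (n::nat)) \<and>
    (y' [^]\<^bsub>S2\<^esub> n) \<otimes>\<^bsub>S2\<^esub> \<sigma>2 p = \<sigma>2 q \<otimes>\<^bsub>S2\<^esub> (y [^]\<^bsub>S2\<^esub> n)"
proof -
  have "(coset x y, coset x' y') \<in> torsion_rel FS"
    using eq eq_equiv_class[OF _ equiv_torsion_rel[OF comm_monoid_fibered_sum] coset_mem[OF xy(3,4)]]
    by (simp add: torsion_class_def)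
  then obtain n :: nat where n: "n > 0" "coset x y [^]\<^bsub>FS\<^esub> n = coset x' y' [^]\<^bsub>FS\<^esub> n"
    by (auto simp: torsion_rel_def)
  then have "coset (x [^]\<^bsub>S1\<^esub> n) (y [^]\<^bsub>S2\<^esub> n) = coset (x' [^]\<^bsub>S1\<^esub> n) (y' [^]\<^bsub>S2\<^esub> n)"
    using xy by (simp add: coset_pow)
  from coset_eqD[OF _ _ _ _ this] xy n(1) show ?thesis by auto
qed

end

section \<open>The gluing as a tensor product\<close>

lemma pow_additive_monoid: "x [^]\<^bsub>additive_monoid S\<^esub> n = multiple n x"
  by (induction n) (simp_all add: multiple_Suc add.commute)

theorem theorem5p2:
  fixes \<kappa> :: "'k::field itself"
    and d a b :: nat
    and S1 S2 :: "(nat \<Rightarrow>\<^sub>0 nat) set"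
  assumes "S1 \<subseteq> exponents {1..d}" and "positive_affine_semigroup (additive_monoid S1)"
    and "S2 \<subseteq> exponents {1..d}" and "positive_affine_semigroup (additive_monoid S2)"
    and "can_be_glued \<kappa> a b S1 S2"
  defines "R \<equiv> semigroup_ring \<kappa> (UNIV :: nat set)"
    and "R1 \<equiv> semigroup_ring \<kappa> S1"
    and "R2 \<equiv> semigroup_ring \<kappa> S2"
  shows "\<exists>\<sigma>1 \<sigma>2 f1 f2.
    semigroup_ring_hom \<kappa> (additive_monoid (UNIV :: nat set)) (additive_monoid S1) \<sigma>1 f1 \<and>
    semigroup_ring_hom \<kappa> (additive_monoid (UNIV :: nat set)) (additive_monoid S2) \<sigma>2 f2 \<and>
    algebra_isomorphic (semigroup_ring \<kappa> (glued_semigroup a b S1 S2))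
      (tensor_product R R1 R2 f1 f2) \<and>
    algebra_isomorphic
      (tensor_tilde \<kappa> (additive_monoid (UNIV :: nat set)) (additive_monoid S1) (additive_monoid S2)
        \<sigma>1 \<sigma>2)
      (tensor_product R R1 R2 f1 f2)"
proof -
  let ?S = "additive_monoid (UNIV :: nat set)" and ?S1 = "additive_monoid S1" and ?S2 = "additive_monoid S2"
  have ab: "a > 0" "b > 0" using assms(5) by (auto simp: can_be_glued_def)
  have c1: "comm_monoid_cancel ?S1" and c2: "comm_monoid_cancel ?S2"
    using assms(2,4) by (auto simp: positive_affine_semigroup_def affine_semigroup_def)
  interpret S1: comm_monoid_cancel ?S1 by (rule c1)
  interpret S2: comm_monoid_cancel ?S2 by (rule c2)
  have closed: "0 \<in> S1" "0 \<in> S2" "\<And>x y. x \<in> S1 \<Longrightarrow> y \<in> S1 \<Longrightarrow> x + y \<in> S1" "\<And>x y. x \<in> S2 \<Longrightarrow> y \<in> S2 \<Longrightarrow> x + y \<in> S2"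
    using S1.one_closed S2.one_closed S1.m_closed S2.m_closed by simp_all
  obtain \<alpha> \<beta> where \<alpha>: "\<alpha> \<in> S1" and \<beta>: "\<beta> \<in> S2" and \<alpha>\<beta>: "multiple a \<alpha> = multiple b \<beta>"
    and exchange: "\<And>x x' y y'. x \<in> S1 \<Longrightarrow> x' \<in> S1 \<Longrightarrow> y \<in> S2 \<Longrightarrow> y' \<in> S2 \<Longrightarrow>
       multiple a x + multiple b y = multiple a x' + multiple b y' \<Longrightarrow>
       \<exists>k. (x' = multiple k \<alpha> + x \<and> y = multiple k \<beta> + y') \<or> (x = multiple k \<alpha> + x' \<and> y' = multiple k \<beta> + y)"
    using gluing_exchange[OF assms(5)] by blast
  define \<sigma>1 where "\<sigma>1 = (\<lambda>n. multiple n \<alpha>)"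
  define \<sigma>2 where "\<sigma>2 = (\<lambda>n. multiple n \<beta>)"
  have "multiple n \<alpha> \<in> S1" "multiple n \<beta> \<in> S2" for n
    by (induction n) (use \<alpha> \<beta> closed in \<open>auto simp: multiple_Suc\<close>)
  then have \<sigma>: "\<sigma>1 \<in> monoid_hom ?S ?S1" "\<sigma>2 \<in> monoid_hom ?S ?S2"
    by (auto simp: monoid_hom_def hom_def \<sigma>1_def \<sigma>2_def multiple_add_left)
  have S: "comm_monoid_cancel ?S"
    by (intro comm_monoid_cancelI comm_monoid_additive_monoid) auto
  interpret cancellative_span ?S ?S1 ?S2 \<sigma>1 \<sigma>2
    by unfold_locales (use S c1 c2 \<sigma> in auto)
  have glued: "exchange_pushout ?S ?S1 ?S2 (additive_monoid (glued_semigroup a b S1 S2)) \<sigma>1 \<sigma>2 (multiple a) (multiple b)"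
  proof (rule exchange_pushout.intro)
    show "comm_monoid (additive_monoid (glued_semigroup a b S1 S2))"
    proof (rule comm_monoid_additive_monoid)
      show "0 \<in> glued_semigroup a b S1 S2"
        using closed(1,2) unfolding glued_semigroup_def by force
      show "u + v \<in> glued_semigroup a b S1 S2"
        if "u \<in> glued_semigroup a b S1 S2" "v \<in> glued_semigroup a b S1 S2" for u v
      proof -
        from that obtain x y x' y' where uv: "u = multiple a x + multiple b y" "v = multiple a x' + multiple b y'"
          "x \<in> S1" "y \<in> S2" "x' \<in> S1" "y' \<in> S2" unfolding glued_semigroup_def by blast
        then have "u + v = multiple a (x + x') + multiple b (y + y')"
          by (simp add: multiple_add add_ac)
        with uv closed show ?thesis unfolding glued_semigroup_def by blast
      qed
    qed
    show "multiple a \<in> monoid_hom ?S1 (additive_monoid (glued_semigroup a b S1 S2))"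
      "multiple b \<in> monoid_hom ?S2 (additive_monoid (glued_semigroup a b S1 S2))"
      using closed(1,2) by (force simp: monoid_hom_def hom_def multiple_add glued_semigroup_def)+
  next
    fix s show "multiple a (\<sigma>1 s) = multiple b (\<sigma>2 s)"
      using arg_cong[OF \<alpha>\<beta>, of "multiple s"] by (simp add: \<sigma>1_def \<sigma>2_def multiple_multiple mult.commute)
  next
    fix x y x' y' assume "x \<in> carrier ?S1" "y \<in> carrier ?S2" "x' \<in> carrier ?S1" "y' \<in> carrier ?S2"
      "multiple a x \<otimes>\<^bsub>additive_monoid (glued_semigroup a b S1 S2)\<^esub> multiple b y
        = multiple a x' \<otimes>\<^bsub>additive_monoid (glued_semigroup a b S1 S2)\<^esub> multiple b y'"
    then show "\<exists>s\<in>carrier ?S. (x' = \<sigma>1 s \<otimes>\<^bsub>?S1\<^esub> x \<and> y = \<sigma>2 s \<otimes>\<^bsub>?S2\<^esub> y') \<or>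
        (x = \<sigma>1 s \<otimes>\<^bsub>?S1\<^esub> x' \<and> y' = \<sigma>2 s \<otimes>\<^bsub>?S2\<^esub> y)"
      using exchange[of x x' y y'] by (simp add: \<sigma>1_def \<sigma>2_def)
  qed (use \<sigma> S.comm_monoid_axioms S1.comm_monoid_axioms S2.comm_monoid_axioms in \<open>auto simp: glued_semigroup_def\<close>)
  have fibered: "exchange_pushout ?S ?S1 ?S2 FT \<sigma>1 \<sigma>2 (\<lambda>x. torsion_class x 0) (\<lambda>y. torsion_class 0 y)"
  proof (rule exchange_pushout.intro)
    show "(\<lambda>x. torsion_class x 0) \<in> monoid_hom ?S1 FT" "(\<lambda>y. torsion_class 0 y) \<in> monoid_hom ?S2 FT"
      using closed by (auto simp: monoid_hom_def hom_def carrier_fibered_sum_mod_torsion one_fibered_sum_mod_torsion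
          torsion_class_mult)
  next
    fix s show "torsion_class (\<sigma>1 s) 0 = torsion_class 0 (\<sigma>2 s)"
      using coset_commute[of s] by (simp add: torsion_class_def)
  next
    show "carrier FT \<subseteq> {torsion_class x 0 \<otimes>\<^bsub>FT\<^esub> torsion_class 0 y | x y. x \<in> carrier ?S1 \<and> y \<in> carrier ?S2}"
    proof
      fix z assume "z \<in> carrier FT"
      then obtain x y where "z = torsion_class x y" "x \<in> S1" "y \<in> S2"
        by (auto simp: carrier_fibered_sum_mod_torsion)
      moreover from this have "z = torsion_class x 0 \<otimes>\<^bsub>FT\<^esub> torsion_class 0 y"
        using torsion_class_mult[of x 0 0 y] closed by simp
      ultimately show "z \<in> {torsion_class x 0 \<otimes>\<^bsub>FT\<^esub> torsion_class 0 y | x y. x \<in> carrier ?S1 \<and> y \<in> carrier ?S2}"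
        by auto
    qed
  next
    fix x y x' y' assume m: "x \<in> carrier ?S1" "y \<in> carrier ?S2" "x' \<in> carrier ?S1" "y' \<in> carrier ?S2"
      and "torsion_class x 0 \<otimes>\<^bsub>FT\<^esub> torsion_class 0 y = torsion_class x' 0 \<otimes>\<^bsub>FT\<^esub> torsion_class 0 y'"
    then have "torsion_class x y = torsion_class x' y'"
      using torsion_class_mult[of x 0 0 y] torsion_class_mult[of x' 0 0 y'] closed by simp
    from torsion_class_eqD[OF m this] obtain n p q where n: "n > 0"
      and 1: "multiple n x' + multiple q \<alpha> = multiple p \<alpha> + multiple n x"
      and 2: "multiple n y' + multiple p \<beta> = multiple q \<beta> + multiple n y"
      by (auto simp: pow_additive_monoid \<sigma>1_def \<sigma>2_def)
    \<comment> \<open>applying \<open>a\<close> to the first and \<open>b\<close> to the second equation, the extra terms add up to the same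
      multiple of \<open>a \<alpha> = b \<beta>\<close> on both sides\<close>
    have swap: "multiple b (multiple k \<beta>) = multiple a (multiple k \<alpha>)" for k
      using arg_cong[OF \<alpha>\<beta>, of "multiple k"] by (simp add: multiple_multiple mult.commute)
    have "multiple a (multiple n x') + multiple b (multiple n y') + (multiple a (multiple q \<alpha>) + multiple a (multiple p \<alpha>))
      = multiple a (multiple n x' + multiple q \<alpha>) + multiple b (multiple n y' + multiple p \<beta>)"
      by (simp add: multiple_add swap add_ac)
    also have "\<dots> = multiple a (multiple n x) + multiple b (multiple n y) + (multiple a (multiple q \<alpha>) + multiple a (multiple p \<alpha>))"
      unfolding 1 2 by (simp add: multiple_add swap add_ac)
    finally have "multiple n (multiple a x' + multiple b y') = multiple n (multiple a x + multiple b y)"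
      by (simp add: multiple_add multiple_multiple mult.commute)
    then have "multiple a x + multiple b y = multiple a x' + multiple b y'"
      by (simp add: multiple_cancel[OF n])
    then show "\<exists>s\<in>carrier ?S. (x' = \<sigma>1 s \<otimes>\<^bsub>?S1\<^esub> x \<and> y = \<sigma>2 s \<otimes>\<^bsub>?S2\<^esub> y') \<or>
        (x = \<sigma>1 s \<otimes>\<^bsub>?S1\<^esub> x' \<and> y' = \<sigma>2 s \<otimes>\<^bsub>?S2\<^esub> y)"
      using exchange[of x x' y y'] m by (simp add: \<sigma>1_def \<sigma>2_def)
  qed (use \<sigma> S.comm_monoid_axioms S1.comm_monoid_axioms S2.comm_monoid_axioms comm_monoid_fibered_sum_mod_torsion in auto)
  show ?thesis
    using exchange_pushout.tensor_product_isomorphic[OF glued, of \<kappa>]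
      exchange_pushout.tensor_product_isomorphic[OF fibered, of \<kappa>]
      semigroup_ring_hom_induced[OF \<sigma>(1), of \<kappa>] semigroup_ring_hom_induced[OF \<sigma>(2), of \<kappa>]
    unfolding R_def R1_def R2_def tensor_tilde_def by blast
qed

end
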